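(* Let $k$ be an even positive integer, $m\ge1$, and let $\phi,\psi\in J_{k,m}$ have theta expansions $\phi=\sum_{\mu\bmod 2m}g_\mu\,\theta_{m,\mu}$ and $\psi=\sum_{\mu\bmod 2m}h_\mu\,\theta_{m,\mu}$. Then $$\int_{\Gamma^J\backslash\mathbf H_1\times\mathbf C}\mathcal D^J\big(\phi\overline\psi\,e^{-4\pi m\frac{y^2}{v}}v^k\big)\frac{du\,dx\,dv\,dy}{v^3}=\frac1{\sqrt{4m}}\int_{\mathrm{SL}(2,\mathbf Z)\backslash\mathbf H_1}\ \sum_{\mu\bmod 2m}\mathbb D_{k-\frac12}\big(g_\mu\overline{h_\mu}\,v^{k-\frac12}\big)\frac{du\,dv}{v^2}.$$
   Context: $\mathbf H_1$ is the upper half plane; $\tau=u+iv\in\mathbf H_1$, $z=x+iy\in\mathbf C$, $e(x)=e^{2\pi ix}$. $J_{k,m}$ is the space of Jacobi forms of weight $k$ and index $m$ on $\Gamma^J=\mathrm{SL}(2,\mathbf Z)\ltimes\mathbf Z^2$. The theta functions are $\theta_{m,\mu}(\tau,z)=\sum_{r\in\mathbf Z,\ r\equiv\mu\bmod 2m}e\big(\tfrac{r^2}{4m}\tau+rz\big)$; every $\phi\in J_{k,m}$ has a unique expansion $\phi=\sum_{\mu\bmod2m}g_\mu(\tau)\theta_{m,\mu}(\tau,z)$ with $g_\mu$ holomorphic modular forms of weight $k-\frac12$ on $\Gamma(4m)$. The operators are $$\mathcal D^J=4v^2\partial_\tau\partial_{\bar\tau}+4y^2\partial_z\partial_{\bar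 z}+4vy\,(\partial_{\bar\tau}\partial_z+\partial_\tau\partial_{\bar z})-(k-\tfrac12)(k-\tfrac32),$$ and for real $\kappa$, $\mathbb D_\kappa=v^2\Big(\frac{\partial^2}{\partial u^2}+\frac{\partial^2}{\partial v^2}\Big)-\kappa(\kappa-1)$ on functions on $\mathbf H_1$. The fundamental domain for $\Gamma^J$ on $\mathbf H_1\times\mathbf C$ is taken as: $\tau$ in a fundamental domain of $\mathrm{SL}(2,\mathbf Z)\backslash\mathbf H_1$, $x$ mod $1$, $y$ mod $v$. *)

theory Defs
  imports "HOL-Analysis.Analysis"
begin

definition e :: "complex \<Rightarrow> complex" where
  "e w = exp (2 * of_real pi * \<i> * w)"

text \<open>
  Holomorphy in two complex variables on the product of the upper half plane and the complex
  plane: the real total derivative exists and is complex linear.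
\<close>

definition holomorphic2 :: "(complex \<Rightarrow> complex \<Rightarrow> complex) \<Rightarrow> bool" where
  "holomorphic2 \<phi> \<longleftrightarrow>
     (\<forall>\<tau> z. Im \<tau> > 0 \<longrightarrow>
        (\<exists>a b. ((\<lambda>(t, w). \<phi> t w) has_derivative (\<lambda>(s, w). a * s + b * w)) (at (\<tau>, z))))"

text \<open>
  Invariance under the Jacobi group is stated for its two parts separately: the elements of
  the modular group and the elements \<open>(l, j)\<close> of the lattice.  The Fourier condition carries the
  requirement at the cusp (convergence of the double series is unconditional, hence absolute).
\<close>

definition jacobi_form :: "nat \<Rightarrow> nat \<Rightarrow> (complex \<Rightarrow> complex \<Rightarrow> complex) \<Rightarrow> bool" where
  "jacobi_form k m \<phi> \<longleftrightarrow>
     holomorphic2 \<phi> \<and>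
     (\<forall>(a::int) (b::int) (c::int) (d::int) \<tau> z. a * d - b * c = 1 \<longrightarrow> Im \<tau> > 0 \<longrightarrow>
        \<phi> ((of_int a * \<tau> + of_int b) / (of_int c * \<tau> + of_int d)) (z / (of_int c * \<tau> + of_int d))
          = (of_int c * \<tau> + of_int d) ^ k
            * e (of_nat m * of_int c * z\<^sup>2 / (of_int c * \<tau> + of_int d)) * \<phi> \<tau> z) \<and>
     (\<forall>(l::int) (j::int) \<tau> z. Im \<tau> > 0 \<longrightarrow>
        \<phi> \<tau> (z + of_int l * \<tau> + of_int j)
          = e (- of_nat m * ((of_int l)\<^sup>2 * \<tau> + 2 * of_int l * z)) * \<phi> \<tau> z) \<and>
     (\<exists>C :: int \<Rightarrow> int \<Rightarrow> complex. \<forall>\<tau> z. Im \<tau> > 0 \<longrightarrow>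
        ((\<lambda>(n, r). C n r * e (of_int n * \<tau> + of_int r * z)) has_sum \<phi> \<tau> z)
          {(n, r). 0 \<le> n \<and> r\<^sup>2 \<le> 4 * n * int m})"

definition jtheta :: "nat \<Rightarrow> int \<Rightarrow> complex \<Rightarrow> complex \<Rightarrow> complex" where
  "jtheta m \<mu> \<tau> z =
     (\<Sum>\<^sub>\<infinity>r \<in> {r::int. r mod (2 * int m) = \<mu> mod (2 * int m)}.
        e ((of_int r)\<^sup>2 / (4 * of_nat m) * \<tau> + of_int r * z))"

text \<open>
  Only the values of \<open>g\<close> at the representatives \<open>0, \<dots>, 2m - 1\<close> matter.  On the upper half
  plane these are determined by \<open>\<phi>\<close>, because for fixed \<open>\<tau>\<close> the theta functions are linearly
  independent in \<open>z\<close>; holomorphy and modularity of the \<open>g \<mu>\<close> are thus properties of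
  \<open>\<phi>\<close> and not further conditions.
\<close>

definition theta_expansion ::
  "nat \<Rightarrow> (complex \<Rightarrow> complex \<Rightarrow> complex) \<Rightarrow> (int \<Rightarrow> complex \<Rightarrow> complex) \<Rightarrow> bool" where
  "theta_expansion m \<phi> g \<longleftrightarrow>
     (\<forall>\<tau> z. Im \<tau> > 0 \<longrightarrow> \<phi> \<tau> z = (\<Sum>\<mu>\<in>{0..<2 * int m}. g \<mu> \<tau> * jtheta m \<mu> \<tau> z))"

definition d_re :: "(complex \<Rightarrow> complex) \<Rightarrow> complex \<Rightarrow> complex" where
  "d_re f w = vector_derivative (\<lambda>t::real. f (w + of_real t)) (at 0)"

definition d_im :: "(complex \<Rightarrow> complex) \<Rightarrow> complex \<Rightarrow> complex" where
  "d_im f w = vector_derivative (\<lambda>t::real. f (w + \<i> * of_real t)) (at 0)"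

definition d_hol :: "(complex \<Rightarrow> complex) \<Rightarrow> complex \<Rightarrow> complex" where
  "d_hol f w = (d_re f w - \<i> * d_im f w) / 2"

definition d_bar :: "(complex \<Rightarrow> complex) \<Rightarrow> complex \<Rightarrow> complex" where
  "d_bar f w = (d_re f w + \<i> * d_im f w) / 2"

definition D_tau :: "(complex \<Rightarrow> complex \<Rightarrow> complex) \<Rightarrow> complex \<Rightarrow> complex \<Rightarrow> complex" where
  "D_tau f \<tau> z = d_hol (\<lambda>t. f t z) \<tau>"

definition D_taubar :: "(complex \<Rightarrow> complex \<Rightarrow> complex) \<Rightarrow> complex \<Rightarrow> complex \<Rightarrow> complex" where
  "D_taubar f \<tau> z = d_bar (\<lambda>t. f t z) \<tau>"

definition D_z :: "(complex \<Rightarrow> complex \<Rightarrow> complex) \<Rightarrow> complex \<Rightarrow> complex \<Rightarrow> complex" where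
  "D_z f \<tau> z = d_hol (\<lambda>w. f \<tau> w) z"

definition D_zbar :: "(complex \<Rightarrow> complex \<Rightarrow> complex) \<Rightarrow> complex \<Rightarrow> complex \<Rightarrow> complex" where
  "D_zbar f \<tau> z = d_bar (\<lambda>w. f \<tau> w) z"

definition DJ :: "nat \<Rightarrow> (complex \<Rightarrow> complex \<Rightarrow> complex) \<Rightarrow> complex \<Rightarrow> complex \<Rightarrow> complex" where
  "DJ k f \<tau> z =
     of_real (4 * (Im \<tau>)\<^sup>2) * D_tau (D_taubar f) \<tau> z
     + of_real (4 * (Im z)\<^sup>2) * D_z (D_zbar f) \<tau> z
     + of_real (4 * Im \<tau> * Im z) * (D_taubar (D_z f) \<tau> z + D_tau (D_zbar f) \<tau> z)
     - of_real ((real k - 1/2) * (real k - 3/2)) * f \<tau> z"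

definition DD :: "real \<Rightarrow> (complex \<Rightarrow> complex) \<Rightarrow> complex \<Rightarrow> complex" where
  "DD \<kappa> f \<tau> =
     of_real ((Im \<tau>)\<^sup>2) * (d_re (d_re f) \<tau> + d_im (d_im f) \<tau>)
     - of_real (\<kappa> * (\<kappa> - 1)) * f \<tau>"

definition fund_dom :: "complex set" where
  "fund_dom = {\<tau>. Im \<tau> > 0 \<and> \<bar>Re \<tau>\<bar> \<le> 1/2 \<and> cmod \<tau> \<ge> 1}"

definition fibre :: "complex \<Rightarrow> complex set" where
  "fibre \<tau> = {z. 0 \<le> Re z \<and> Re z < 1 \<and> 0 \<le> Im z \<and> Im z < Im \<tau>}"

text \<open>
  The measure \<open>lborel\<close> on the complex numbers is the area measure.

  The integral over the quotient by the Jacobi group is the iterated one, first over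
  \<open>x\<close> mod \<open>1\<close> and \<open>y\<close> mod \<open>v\<close>, then over \<open>\<tau>\<close>.  The order matters: for
  \<open>f = DJ k (\<phi> \<psi>bar exp (- 4 \<pi> m y^2 / v) v^k)\<close> with \<open>\<phi>\<close> and \<open>\<psi>\<close> not cusp forms, integrating
  \<open>\<bar>f\<bar> / v^3\<close> over the fibre in general leaves growth of order \<open>v powr (k - 5/2)\<close>, so that \<open>f\<close> is not
  absolutely integrable jointly in \<open>(\<tau>, z)\<close>; in the fibre integral of \<open>f\<close> itself these terms cancel.
\<close>

definition jacobi_integrable :: "(complex \<Rightarrow> complex \<Rightarrow> complex) \<Rightarrow> bool" where
  "jacobi_integrable f \<longleftrightarrow>
     (\<forall>\<tau>\<in>fund_dom. set_integrable lborel (fibre \<tau>) (f \<tau>)) \<and>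
     set_integrable lborel fund_dom (\<lambda>\<tau>. (LINT z:fibre \<tau>|lborel. f \<tau> z) / of_real (Im \<tau> ^ 3))"

definition jacobi_integral :: "(complex \<Rightarrow> complex \<Rightarrow> complex) \<Rightarrow> complex" where
  "jacobi_integral f =
     (LINT \<tau>:fund_dom|lborel. (LINT z:fibre \<tau>|lborel. f \<tau> z) / of_real (Im \<tau> ^ 3))"

definition modular_integrable :: "(complex \<Rightarrow> complex) \<Rightarrow> bool" where
  "modular_integrable f \<longleftrightarrow> set_integrable lborel fund_dom (\<lambda>\<tau>. f \<tau> / of_real ((Im \<tau>)\<^sup>2))"

definition modular_integral :: "(complex \<Rightarrow> complex) \<Rightarrow> complex" where
  "modular_integral f = (LINT \<tau>:fund_dom|lborel. f \<tau> / of_real ((Im \<tau>)\<^sup>2))"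

end

theory Submission
  imports Defs "HOL-Complex_Analysis.Complex_Analysis" "HOL-Probability.Probability"
    "HOL-Real_Asymp.Real_Asymp"
begin

text \<open>
  The identity holds fibre by fibre: for each \<open>\<tau>\<close> the integral over \<open>z\<close> of the left integrand, divided
  by \<open>v\<^sup>3\<close>, equals \<open>1 / sqrt (4 m)\<close> times the right integrand divided by \<open>v\<^sup>2\<close>.

  Write \<open>z = p \<tau> + q\<close> with \<open>p = y / v\<close> and \<open>q\<close> real.  In the coordinates \<open>(\<tau>, p, q)\<close> the operator
  \<open>DJ k\<close> is \<open>v\<^sup>2\<close> times the Laplacian in \<open>\<tau>\<close> minus a constant, and \<open>\<phi> \<tau> (p \<tau> + q) \<cdot> e (m p\<^sup>2 \<tau>)\<close> is
  holomorphic in \<open>\<tau>\<close>.  As the Laplacian of \<open>\<Phi> cnj \<Psi> v^k\<close> contains \<open>\<Phi>\<close> and \<open>\<Psi>\<close> only up to first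
  derivatives, \<open>DJ k F\<close> is a sesquilinear expression in \<open>\<phi>, \<psi>\<close> and one first order derivative of
  each (\<open>DJ_formula\<close>).

  At fixed \<open>\<tau>\<close> and \<open>y\<close> these functions are Fourier series in \<open>x\<close>, obtained by differentiating the
  theta series termwise, so that Parseval's identity (\<open>parseval\<close>) integrates over \<open>x\<close>.  The result is a
  sum over \<open>r\<close> of a quartic polynomial times a Gaussian, evaluated at \<open>r / (2 m) + y / v\<close>; the
  integral over \<open>0 \<le> y \<le> v\<close> unfolds the sum over each residue class of \<open>r\<close> to an integral over the
  whole line (\<open>theta_unfolding\<close>).  Inserting the Gaussian moments of order 0, 2 and 4, the terms
  \<open>g cnj h\<close> cancel, and what remains is the weight \<open>k - 1/2\<close> operator applied to
  \<open>g cnj h v powr (k - 1/2)\<close>, in the form computed by \<open>DD_formula\<close>.  Integrating the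
  Gaussian is what lowers the weight by a half.

  For convergence over the fundamental domain, every term of \<open>DD_formula\<close> contains a derivative of
  \<open>g\<close> or \<open>h\<close>.  Comparing Fourier coefficients in \<open>z\<close> turns the cusp condition for \<open>\<phi>\<close> into
  \<open>g \<mu> \<tau> = e (\<delta> \<tau>) Q (e \<tau>)\<close> with \<open>\<delta> \<ge> 0\<close> and \<open>Q\<close> holomorphic on the unit disc
  (\<open>theta_coefficient_power_series\<close>).  Hence \<open>g \<mu>\<close> is bounded on the fundamental domain and
  its derivative decays exponentially there, which makes the right integrand absolutely integrable even if \<open>\<phi>\<close> and \<open>\<psi>\<close> are not cusp forms.
\<close>

section \<open>Wirtinger derivatives and the two operators\<close>

text \<open>
  \<open>d_hol\<close> and \<open>d_bar\<close> are built from \<open>vector_derivative\<close>, which is unspecified where a directional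
  derivative does not exist.  This predicate records existence together with the two values, as the full
  real derivative, and is therefore closed under products and local changes of the function.
\<close>

definition has_wirtinger ::
  "(complex \<Rightarrow> complex) \<Rightarrow> complex \<Rightarrow> complex \<Rightarrow> complex \<Rightarrow> bool" where
  "has_wirtinger f a b w \<longleftrightarrow> (f has_derivative (\<lambda>s. a * s + b * cnj s)) (at w)"

lemma has_wirtinger_d_re:
  assumes "has_wirtinger f a b w"
  shows "d_re f w = a + b"
proof -
  have "((\<lambda>t::real. f (w + of_real t)) has_derivative (\<lambda>t. a * of_real t + b * cnj (of_real t))) (at 0)"
    by (rule has_derivative_compose[of "\<lambda>t::real. w + of_real t" of_real, where g = f])
       (use assms in \<open>auto simp: has_wirtinger_def intro!: derivative_eq_intros\<close>)
  then have "((\<lambda>t::real. f (w + of_real t)) has_vector_derivative (a + b)) (at 0)"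
    unfolding has_vector_derivative_def
    by (rule has_derivative_eq_rhs) (auto simp: fun_eq_iff scaleR_conv_of_real algebra_simps)
  then show ?thesis
    unfolding d_re_def by (rule vector_derivative_at)
qed

lemma has_wirtinger_d_im:
  assumes "has_wirtinger f a b w"
  shows "d_im f w = \<i> * (a - b)"
proof -
  have "((\<lambda>t::real. f (w + \<i> * of_real t)) has_derivative
          (\<lambda>t. a * (\<i> * of_real t) + b * cnj (\<i> * of_real t))) (at 0)"
    by (rule has_derivative_compose[of "\<lambda>t::real. w + \<i> * of_real t" "\<lambda>t. \<i> * of_real t", where g = f])
       (use assms in \<open>auto simp: has_wirtinger_def intro!: derivative_eq_intros\<close>)
  then have "((\<lambda>t::real. f (w + \<i> * of_real t)) has_vector_derivative (\<i> * (a - b))) (at 0)"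
    unfolding has_vector_derivative_def
    by (rule has_derivative_eq_rhs) (auto simp: fun_eq_iff scaleR_conv_of_real algebra_simps)
  then show ?thesis
    unfolding d_im_def by (rule vector_derivative_at)
qed

lemma has_wirtinger_d_hol: "has_wirtinger f a b w \<Longrightarrow> d_hol f w = a"
  unfolding d_hol_def by (simp add: has_wirtinger_d_re has_wirtinger_d_im algebra_simps)

lemma has_wirtinger_d_bar: "has_wirtinger f a b w \<Longrightarrow> d_bar f w = b"
  unfolding d_bar_def by (simp add: has_wirtinger_d_re has_wirtinger_d_im algebra_simps)

lemma has_wirtinger_eq:
  "has_wirtinger f a b w \<Longrightarrow> a = a' \<Longrightarrow> b = b' \<Longrightarrow> has_wirtinger f a' b' w"
  by simp

lemma has_wirtinger_add:
  assumes "has_wirtinger f a b w" "has_wirtinger g c d w"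
  shows "has_wirtinger (\<lambda>s. f s + g s) (a + c) (b + d) w"
  using has_derivative_add[OF assms[unfolded has_wirtinger_def]]
  unfolding has_wirtinger_def by (rule has_derivative_eq_rhs) (auto simp: fun_eq_iff algebra_simps)

lemma has_wirtinger_mult:
  assumes "has_wirtinger f a b w" "has_wirtinger g c d w"
  shows "has_wirtinger (\<lambda>s. f s * g s) (f w * c + a * g w) (f w * d + b * g w) w"
  using has_derivative_mult[OF assms[unfolded has_wirtinger_def]]
  unfolding has_wirtinger_def by (rule has_derivative_eq_rhs) (auto simp: fun_eq_iff algebra_simps)

lemma has_wirtinger_const: "has_wirtinger (\<lambda>s. c) 0 0 w"
  unfolding has_wirtinger_def by simp

lemma has_wirtinger_holomorphic:
  "(f has_field_derivative f') (at w) \<Longrightarrow> has_wirtinger f f' 0 w"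
  unfolding has_wirtinger_def has_field_derivative_def by simp

lemma has_wirtinger_cnj:
  assumes "(f has_field_derivative f') (at w)"
  shows "has_wirtinger (\<lambda>s. cnj (f s)) 0 (cnj f') w"
  using bounded_linear.has_derivative[OF bounded_linear_cnj assms[unfolded has_field_derivative_def]]
  unfolding has_wirtinger_def by (rule has_derivative_eq_rhs) (auto simp: fun_eq_iff)

lemma has_wirtinger_Im:
  assumes "(f has_real_derivative f') (at (Im w))"
  shows "has_wirtinger (\<lambda>s. of_real (f (Im s))) (- \<i> / 2 * of_real f') (\<i> / 2 * of_real f') w"
proof -
  have Im: "(Im has_derivative Im) (at w)"
    by (rule bounded_linear.has_derivative[OF bounded_linear_Im]) auto
  have "((\<lambda>s. f (Im s)) has_derivative (\<lambda>s. f' * Im s)) (at w)"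
    by (rule has_derivative_compose[OF Im assms[unfolded has_field_derivative_def]])
  then have "((\<lambda>s. complex_of_real (f (Im s))) has_derivative (\<lambda>s. of_real (f' * Im s))) (at w)"
    by (rule bounded_linear.has_derivative[OF bounded_linear_of_real])
  then show ?thesis
    unfolding has_wirtinger_def
    by (rule has_derivative_eq_rhs) (auto simp: fun_eq_iff complex_eq_iff)
qed

lemma has_wirtinger_transform:
  assumes "has_wirtinger f a b w" "open S" "w \<in> S" "\<And>s. s \<in> S \<Longrightarrow> f s = g s"
  shows "has_wirtinger g a b w"
  using assms has_derivative_transform_within_open unfolding has_wirtinger_def by blast

lemma open_upper_half: "open {t::complex. Im t > 0}"
  by (simp add: open_halfspace_Im_gt)

text \<open>
  Complex derivatives are again holomorphic.  Both operators differentiate twice but the data come with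
  first derivatives only; this supplies the second ones.
\<close>

lemma has_field_derivative_deriv_of_holomorphic:
  fixes f f' :: "complex \<Rightarrow> complex"
  assumes "open S" "\<And>w. w \<in> S \<Longrightarrow> (f has_field_derivative f' w) (at w)" "w \<in> S"
  shows "(f' has_field_derivative deriv f' w) (at w)"
proof -
  have "f holomorphic_on S"
    by (auto simp: holomorphic_on_open[OF assms(1)] intro: assms(2))
  then have "deriv f holomorphic_on S"
    using assms(1) by (rule holomorphic_deriv)
  then have "f' holomorphic_on S"
    by (rule holomorphic_transform) (use assms(2) DERIV_imp_deriv in blast)
  then show ?thesis
    using assms holomorphic_derivI by blast
qed

text \<open>
  Fix \<open>p = y / v\<close> and \<open>q\<close> real and move along \<open>z = p \<tau> + q\<close>.  By the chain rule the second order part of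
  \<open>DJ k\<close> is \<open>v\<^sup>2\<close> times the Laplacian of \<open>\<tau> \<mapsto> F \<tau> (p \<tau> + q)\<close>.  With \<open>c = 4 \<pi> m\<close> the exponential factor
  is \<open>|e (m p\<^sup>2 \<tau>)|\<^sup>2\<close>, so along the section \<open>F = \<Phi> cnj \<Psi> v^k\<close> where \<open>\<Phi> = \<phi> \<cdot> e (m p\<^sup>2 \<tau>)\<close> and \<open>\<Psi>\<close> are
  holomorphic, and \<open>P\<close> and \<open>Q\<close> are the derivatives of \<open>\<Phi>\<close> and \<open>\<Psi>\<close> divided by \<open>e (m p\<^sup>2 \<tau>)\<close>.  Second
  derivatives of \<open>\<phi>\<close> and \<open>\<psi>\<close> do not survive, since each term of the operator pairs a holomorphic with an
  antiholomorphic direction.  The last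
  coefficient is \<open>k (k - 1) - (k - 1/2) (k - 3/2) = k - 3/4\<close>.
\<close>

lemma DJ_formula:
  fixes \<phi> \<phi>t \<phi>z \<psi> \<psi>t \<psi>z :: "complex \<Rightarrow> complex \<Rightarrow> complex" and c :: real and k :: nat and \<tau> z :: complex
  assumes \<phi>t: "\<And>\<tau> z. Im \<tau> > 0 \<Longrightarrow> ((\<lambda>t. \<phi> t z) has_field_derivative \<phi>t \<tau> z) (at \<tau>)"
    and \<phi>z: "\<And>\<tau> z. Im \<tau> > 0 \<Longrightarrow> ((\<lambda>w. \<phi> \<tau> w) has_field_derivative \<phi>z \<tau> z) (at z)"
    and \<phi>zt: "\<And>\<tau> z. Im \<tau> > 0 \<Longrightarrow> (\<lambda>t. \<phi>z t z) field_differentiable (at \<tau>)"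
    and \<psi>t: "\<And>\<tau> z. Im \<tau> > 0 \<Longrightarrow> ((\<lambda>t. \<psi> t z) has_field_derivative \<psi>t \<tau> z) (at \<tau>)"
    and \<psi>z: "\<And>\<tau> z. Im \<tau> > 0 \<Longrightarrow> ((\<lambda>w. \<psi> \<tau> w) has_field_derivative \<psi>z \<tau> z) (at z)"
    and \<psi>zt: "\<And>\<tau> z. Im \<tau> > 0 \<Longrightarrow> (\<lambda>t. \<psi>z t z) field_differentiable (at \<tau>)"
    and \<tau>: "Im \<tau> > 0"
  defines "F \<equiv> (\<lambda>\<tau> z. \<phi> \<tau> z * cnj (\<psi> \<tau> z) * of_real (exp (- c * (Im z)\<^sup>2 / Im \<tau>) * Im \<tau> ^ k))"
    and "p \<equiv> Im z / Im \<tau>"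
  defines "P \<equiv> \<phi>t \<tau> z + of_real p * \<phi>z \<tau> z + \<i> / 2 * of_real (c * p\<^sup>2) * \<phi> \<tau> z"
    and "Q \<equiv> \<psi>t \<tau> z + of_real p * \<psi>z \<tau> z + \<i> / 2 * of_real (c * p\<^sup>2) * \<psi> \<tau> z"
  shows "DJ k F \<tau> z = of_real (exp (- c * (Im z)\<^sup>2 / Im \<tau>) * Im \<tau> ^ k) *
     (4 * of_real (Im \<tau>)^2 * P * cnj Q
      + 2 * \<i> * of_nat k * of_real (Im \<tau>) * (P * cnj (\<psi> \<tau> z) - \<phi> \<tau> z * cnj Q)
      + of_real (real k - 3/4) * \<phi> \<tau> z * cnj (\<psi> \<tau> z))"
proof -
  \<comment> \<open>\<open>A\<close> and \<open>B\<close> are the logarithmic derivatives of the weight \<open>W\<close> with respect to \<open>v\<close> and \<open>y\<close>;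
    \<open>A'\<close>, \<open>Bv\<close> and \<open>By\<close> are their derivatives.\<close>
  define W where "W = (\<lambda>v y. exp (- c * y\<^sup>2 / v) * v ^ k :: real)"
  define A where "A = (\<lambda>v y. c * y\<^sup>2 / v\<^sup>2 + real k / v)"
  define A' where "A' = (\<lambda>v y. - 2 * c * y\<^sup>2 / v^3 - real k / v\<^sup>2)"
  define B where "B = (\<lambda>v y. - 2 * c * y / v)"
  define Bv where "Bv = (\<lambda>v y. 2 * c * y / v\<^sup>2)"
  define By where "By = (\<lambda>v (y::real). - 2 * c / v)"
  have dWv: "((\<lambda>v. W v y) has_real_derivative W v y * A v y) (at v)" if "v > 0" for v y
    unfolding W_def A_def using that
    by (auto intro!: derivative_eq_intros) (cases k; simp add: field_simps power2_eq_square)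
  have dWy: "(W v has_real_derivative W v y * B v y) (at y)" if "v > 0" for v y
    unfolding W_def B_def using that
    by (auto intro!: derivative_eq_intros simp: field_simps power2_eq_square)
  have dAv: "((\<lambda>v. A v y) has_real_derivative A' v y) (at v)" if "v > 0" for v y
    unfolding A_def A'_def using that
    by (auto intro!: derivative_eq_intros simp: field_simps power2_eq_square power3_eq_cube)
  have dBv: "((\<lambda>v. B v y) has_real_derivative Bv v y) (at v)" if "v > 0" for v y
    unfolding B_def Bv_def using that
    by (auto intro!: derivative_eq_intros simp: field_simps power2_eq_square)
  have dBy: "(B v has_real_derivative By v y) (at y)" if "v > 0" for v y
    unfolding B_def By_def using that
    by (auto intro!: derivative_eq_intros simp: field_simps)
  have Feq: "F = (\<lambda>\<tau> z. \<phi> \<tau> z * cnj (\<psi> \<tau> z) * of_real (W (Im \<tau>) (Im z)))"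
    unfolding F_def W_def by simp
  have wWv: "has_wirtinger (\<lambda>t. of_real (W (Im t) y)) (- \<i> / 2 * of_real (W (Im t) y * A (Im t) y))
       (\<i> / 2 * of_real (W (Im t) y * A (Im t) y)) t" if "Im t > 0" for t y
    using has_wirtinger_Im[OF dWv[OF that]] .
  have wWy: "has_wirtinger (\<lambda>z. of_real (W v (Im z))) (- \<i> / 2 * of_real (W v (Im z) * B v (Im z)))
       (\<i> / 2 * of_real (W v (Im z) * B v (Im z))) z" if "v > 0" for v z
    using has_wirtinger_Im[OF dWy[OF that]] .
  have wAv: "has_wirtinger (\<lambda>t. of_real (A (Im t) y)) (- \<i> / 2 * of_real (A' (Im t) y))
       (\<i> / 2 * of_real (A' (Im t) y)) t" if "Im t > 0" for t y
    using has_wirtinger_Im[OF dAv[OF that]] .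
  have wBv: "has_wirtinger (\<lambda>t. of_real (B (Im t) y)) (- \<i> / 2 * of_real (Bv (Im t) y))
       (\<i> / 2 * of_real (Bv (Im t) y)) t" if "Im t > 0" for t y
    using has_wirtinger_Im[OF dBv[OF that]] .
  have wBy: "has_wirtinger (\<lambda>z. of_real (B v (Im z))) (- \<i> / 2 * of_real (By v (Im z)))
       (\<i> / 2 * of_real (By v (Im z))) z" if "v > 0" for v z
    using has_wirtinger_Im[OF dBy[OF that]] .
  have \<phi>tt: "((\<lambda>t. \<phi>t t z) has_field_derivative deriv (\<lambda>t. \<phi>t t z) \<tau>) (at \<tau>)"
    and \<psi>tt: "((\<lambda>t. \<psi>t t z) has_field_derivative deriv (\<lambda>t. \<psi>t t z) \<tau>) (at \<tau>)"
    using has_field_derivative_deriv_of_holomorphic[OF open_upper_half, of "\<lambda>t. \<phi> t z" "\<lambda>t. \<phi>t t z"]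
      has_field_derivative_deriv_of_holomorphic[OF open_upper_half, of "\<lambda>t. \<psi> t z" "\<lambda>t. \<psi>t t z"]
      \<phi>t \<psi>t \<tau> by auto
  have \<phi>zz: "(\<phi>z \<tau> has_field_derivative deriv (\<phi>z \<tau>) z) (at z)"
    and \<psi>zz: "(\<psi>z \<tau> has_field_derivative deriv (\<psi>z \<tau>) z) (at z)"
    using has_field_derivative_deriv_of_holomorphic[of UNIV "\<phi> \<tau>" "\<phi>z \<tau>"]
      has_field_derivative_deriv_of_holomorphic[of UNIV "\<psi> \<tau>" "\<psi>z \<tau>"]
      \<phi>z \<psi>z \<tau> by auto
  have \<phi>zt': "((\<lambda>t. \<phi>z t z) has_field_derivative deriv (\<lambda>t. \<phi>z t z) \<tau>) (at \<tau>)"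
    and \<psi>zt': "((\<lambda>t. \<psi>z t z) has_field_derivative deriv (\<lambda>t. \<psi>z t z) \<tau>) (at \<tau>)"
    using \<phi>zt[OF \<tau>] \<psi>zt[OF \<tau>] DERIV_deriv_iff_field_differentiable by blast+
  note rules = has_wirtinger_add has_wirtinger_mult has_wirtinger_const wWv wWy wAv wBv wBy
  let ?v = "Im \<tau>" let ?y = "Im z"
  define w a b a' bv bby where "w = complex_of_real (W ?v ?y)" and "a = complex_of_real (A ?v ?y)"
    and "b = complex_of_real (B ?v ?y)" and "a' = complex_of_real (A' ?v ?y)"
    and "bv = complex_of_real (Bv ?v ?y)" and "bby = complex_of_real (By ?v ?y)"
  define f ft fz q qt qz where "f = \<phi> \<tau> z" and "ft = \<phi>t \<tau> z" and "fz = \<phi>z \<tau> z"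
    and "q = cnj (\<psi> \<tau> z)" and "qt = cnj (\<psi>t \<tau> z)" and "qz = cnj (\<psi>z \<tau> z)"
  note loc = w_def a_def b_def a'_def bv_def bby_def f_def ft_def fz_def q_def qt_def qz_def
  have Dtb: "D_taubar F t z = \<phi> t z * cnj (\<psi>t t z) * of_real (W (Im t) ?y)
     + \<phi> t z * cnj (\<psi> t z) * (\<i> / 2 * (of_real (W (Im t) ?y) * of_real (A (Im t) ?y)))"
    if "Im t > 0" for t
    unfolding D_taubar_def Feq
    by (rule has_wirtinger_d_bar, rule has_wirtinger_eq)
       (rule rules has_wirtinger_holomorphic[OF \<phi>t] has_wirtinger_cnj[OF \<psi>t] that refl
         | (simp add: algebra_simps; fail))+
  have Dzb: "D_zbar F t z = \<phi> t z * cnj (\<psi>z t z) * of_real (W (Im t) (Im z))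
     + \<phi> t z * cnj (\<psi> t z) * (\<i> / 2 * (of_real (W (Im t) (Im z)) * of_real (B (Im t) (Im z))))"
    if "Im t > 0" for t z
    unfolding D_zbar_def Feq
    by (rule has_wirtinger_d_bar, rule has_wirtinger_eq)
       (rule rules has_wirtinger_holomorphic[OF \<phi>z] has_wirtinger_cnj[OF \<psi>z] that refl
         | (simp add: algebra_simps; fail))+
  have Dz: "D_z F t z = \<phi>z t z * cnj (\<psi> t z) * of_real (W (Im t) ?y)
     + \<phi> t z * cnj (\<psi> t z) * (- \<i> / 2 * (of_real (W (Im t) ?y) * of_real (B (Im t) ?y)))"
    if "Im t > 0" for t
    unfolding D_z_def Feq
    by (rule has_wirtinger_d_hol, rule has_wirtinger_eq)
       (rule rules has_wirtinger_holomorphic[OF \<phi>z] has_wirtinger_cnj[OF \<psi>z] that refl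
         | (simp add: algebra_simps; fail))+
  have DDt: "D_tau (D_taubar F) \<tau> z = ft * qt * w + f * qt * (- \<i> / 2 * (w * a))
      + ft * q * (\<i> / 2 * (w * a)) + f * q * (w * (a\<^sup>2 + a') / 4)"
    unfolding D_tau_def
    apply (rule has_wirtinger_d_hol, rule has_wirtinger_transform[where f = "\<lambda>t. \<phi> t z * cnj (\<psi>t t z) * of_real (W (Im t) ?y)
     + \<phi> t z * cnj (\<psi> t z) * (\<i> / 2 * (of_real (W (Im t) ?y) * of_real (A (Im t) ?y)))",
        OF _ open_upper_half])
    apply (rule has_wirtinger_eq)
    apply (rule rules has_wirtinger_holomorphic[OF \<phi>t] has_wirtinger_cnj[OF \<psi>t]
        has_wirtinger_cnj[OF \<psi>tt] \<tau> refl)+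
    apply (simp add: loc algebra_simps power2_eq_square)
    using \<tau> Dtb by auto
  have DDz: "D_z (D_zbar F) \<tau> z = fz * qz * w + f * qz * (- \<i> / 2 * (w * b))
      + fz * q * (\<i> / 2 * (w * b)) + f * q * (w * (b\<^sup>2 + bby) / 4)"
    unfolding D_z_def
    apply (rule has_wirtinger_d_hol, rule has_wirtinger_transform[where f = "\<lambda>z. \<phi> \<tau> z * cnj (\<psi>z \<tau> z) * of_real (W ?v (Im z))
     + \<phi> \<tau> z * cnj (\<psi> \<tau> z) * (\<i> / 2 * (of_real (W ?v (Im z)) * of_real (B ?v (Im z))))",
        OF _ open_UNIV])
    apply (rule has_wirtinger_eq)
    apply (rule rules has_wirtinger_holomorphic[OF \<phi>z] has_wirtinger_cnj[OF \<psi>z]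
        has_wirtinger_cnj[OF \<psi>zz] \<tau> refl)+
    apply (simp add: loc algebra_simps power2_eq_square)
    using \<tau> Dzb by auto
  have DDtz: "D_taubar (D_z F) \<tau> z = fz * qt * w + fz * q * (\<i> / 2 * (w * a))
      + f * qt * (- \<i> / 2 * (w * b)) + f * q * (w * (a * b + bv) / 4)"
    unfolding D_taubar_def
    apply (rule has_wirtinger_d_bar, rule has_wirtinger_transform[where f = "\<lambda>t. \<phi>z t z * cnj (\<psi> t z) * of_real (W (Im t) ?y)
     + \<phi> t z * cnj (\<psi> t z) * (- \<i> / 2 * (of_real (W (Im t) ?y) * of_real (B (Im t) ?y)))",
        OF _ open_upper_half])
    apply (rule has_wirtinger_eq)
    apply (rule rules has_wirtinger_holomorphic[OF \<phi>t] has_wirtinger_cnj[OF \<psi>t]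
        has_wirtinger_holomorphic[OF \<phi>zt'] \<tau> refl)+
    apply (simp add: loc algebra_simps power2_eq_square)
    using \<tau> Dz by auto
  have DDzt: "D_tau (D_zbar F) \<tau> z = ft * qz * w + f * qz * (- \<i> / 2 * (w * a))
      + ft * q * (\<i> / 2 * (w * b)) + f * q * (w * (a * b + bv) / 4)"
    unfolding D_tau_def
    apply (rule has_wirtinger_d_hol, rule has_wirtinger_transform[where f = "\<lambda>t. \<phi> t z * cnj (\<psi>z t z) * of_real (W (Im t) ?y)
     + \<phi> t z * cnj (\<psi> t z) * (\<i> / 2 * (of_real (W (Im t) ?y) * of_real (B (Im t) ?y)))",
        OF _ open_upper_half])
    apply (rule has_wirtinger_eq)
    apply (rule rules has_wirtinger_holomorphic[OF \<phi>t] has_wirtinger_cnj[OF \<psi>t]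
        has_wirtinger_cnj[OF \<psi>zt'] \<tau> refl)+
    apply (simp add: loc algebra_simps power2_eq_square)
    using \<tau> Dzb by auto
  define v p' c' K where "v = complex_of_real ?v" and "p' = complex_of_real p"
    and "c' = complex_of_real c" and "K = (of_nat k :: complex)"
  \<comment> \<open>In terms of \<open>p\<close> everything is polynomial in \<open>v\<close>, and \<open>v A + y B = k - c p\<^sup>2 v\<close>.\<close>
  have y: "?y = p * ?v" using \<tau> by (simp add: p_def)
  have av: "a * v = c' * p'^2 * v + K" "b = - 2 * c' * p'"
    "a' * v^2 = - 2 * c' * p'^2 * v - K" "bby * v = - 2 * c'" "bv * v = 2 * c' * p'"
    using \<tau> unfolding a_def b_def a'_def bby_def bv_def A_def B_def A'_def By_def Bv_def y v_def p'_def c'_def K_def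
    by (simp_all add: field_simps power2_eq_square power3_eq_cube)
  have "DJ k F \<tau> z = 4 * v^2 * (ft * qt * w + f * qt * (- \<i> / 2 * (w * a))
      + ft * q * (\<i> / 2 * (w * a)) + f * q * (w * (a\<^sup>2 + a') / 4))
     + 4 * (p' * v)^2 * (fz * qz * w + f * qz * (- \<i> / 2 * (w * b))
      + fz * q * (\<i> / 2 * (w * b)) + f * q * (w * (b\<^sup>2 + bby) / 4))
     + 4 * v * (p' * v) * ((fz * qt * w + fz * q * (\<i> / 2 * (w * a))
      + f * qt * (- \<i> / 2 * (w * b)) + f * q * (w * (a * b + bv) / 4)) + (ft * qz * w + f * qz * (- \<i> / 2 * (w * a))
      + ft * q * (\<i> / 2 * (w * b)) + f * q * (w * (a * b + bv) / 4)))
     - (K - 1/2) * (K - 3/2) * (f * q * w)"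
    unfolding DJ_def DDt DDz DDtz DDzt
    unfolding y v_def p'_def K_def by (simp add: F_def W_def w_def f_def q_def y)
  also have "\<dots> = w * (4 * v^2 * ft * qt + 4 * (p' * v)^2 * fz * qz + 4 * v * (p' * v) * (fz * qt + ft * qz)
      + (- 2 * \<i> * f * qt + 2 * \<i> * ft * q) * (v * (a * v) + p' * v^2 * b)
      + (- 2 * \<i> * f * qz + 2 * \<i> * fz * q) * p' * (v * (a * v) + p' * v^2 * b)
      + f * q * ((a * v)^2 + a' * v^2 + (p' * v * b)^2 + p'^2 * v * (bby * v)
          + 2 * p' * (v * (a * v) * b + v * (bv * v)) - (K - 1/2) * (K - 3/2)))"
    by (simp add: field_simps power2_eq_square)
  also have "\<dots> = w * (4 * v^2 * ft * qt + 4 * (p' * v)^2 * fz * qz + 4 * v * (p' * v) * (fz * qt + ft * qz)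
      + (- 2 * \<i> * f * qt + 2 * \<i> * ft * q) * (v * (K - c' * p'^2 * v))
      + (- 2 * \<i> * f * qz + 2 * \<i> * fz * q) * p' * (v * (K - c' * p'^2 * v))
      + f * q * ((K - c' * p'^2 * v)^2 - K - (K - 1/2) * (K - 3/2)))"
    unfolding av by (simp add: algebra_simps power2_eq_square)
  also have "\<dots> = w *
     (4 * v^2 * (ft + p' * fz + \<i> / 2 * (c' * p'^2) * f) * (qt + p' * qz - \<i> / 2 * (c' * p'^2) * q)
      + 2 * \<i> * K * v * ((ft + p' * fz + \<i> / 2 * (c' * p'^2) * f) * q - f * (qt + p' * qz - \<i> / 2 * (c' * p'^2) * q))
      + (K - 3/4) * f * q)"
    by (simp add: field_simps power2_eq_square)
  finally show ?thesis
    unfolding loc P_def Q_def v_def p'_def c'_def K_def W_def by (simp add: mult.assoc)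
qed

lemma laplacian_wirtinger:
  assumes f: "\<And>t. Im t > 0 \<Longrightarrow> has_wirtinger f (a t) (b t) t"
    and a: "has_wirtinger a aa ab \<tau>" and b: "has_wirtinger b ba bb \<tau>" and \<tau>: "Im \<tau> > 0"
  shows "d_re (d_re f) \<tau> + d_im (d_im f) \<tau> = 2 * (ab + ba)"
proof -
  have 1: "has_wirtinger (d_re f) (aa + ba) (ab + bb) \<tau>"
    by (rule has_wirtinger_transform[OF has_wirtinger_add[OF a b] open_upper_half])
       (use \<tau> has_wirtinger_d_re[OF f] in auto)
  have "has_wirtinger (\<lambda>t. \<i> * (a t + (-1) * b t)) (\<i> * (aa - ba)) (\<i> * (ab - bb)) \<tau>"
    by (rule has_wirtinger_eq[OF has_wirtinger_mult[OF has_wirtinger_const[of \<i>] has_wirtinger_add[OF a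
        has_wirtinger_mult[OF has_wirtinger_const[of "-1"] b]]]])
       (auto simp: algebra_simps)
  then have 2: "has_wirtinger (d_im f) (\<i> * (aa - ba)) (\<i> * (ab - bb)) \<tau>"
    by (rule has_wirtinger_transform[OF _ open_upper_half])
       (use \<tau> has_wirtinger_d_im[OF f] in \<open>auto simp: algebra_simps\<close>)
  show ?thesis
    unfolding has_wirtinger_d_re[OF 1] has_wirtinger_d_im[OF 2] by (simp add: algebra_simps)
qed

text \<open>
  Differentiating only the factor \<open>v powr \<kappa>\<close> produces \<open>\<kappa> (\<kappa> - 1)\<close> times the function itself, which is
  exactly the constant subtracted in \<open>DD \<kappa>\<close>.  So every remaining term contains a derivative of \<open>g\<close> or
  \<open>h\<close>, and this is what makes the modular integral converge.
\<close>

lemma DD_formula: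
  fixes g g' h h' :: "complex \<Rightarrow> complex" and \<kappa> :: real
  assumes g: "\<And>t. Im t > 0 \<Longrightarrow> (g has_field_derivative g' t) (at t)"
    and h: "\<And>t. Im t > 0 \<Longrightarrow> (h has_field_derivative h' t) (at t)"
    and \<tau>: "Im \<tau> > 0"
  shows "DD \<kappa> (\<lambda>t. g t * cnj (h t) * of_real (Im t powr \<kappa>)) \<tau> =
    of_real (Im \<tau> powr \<kappa>) * (4 * of_real (Im \<tau>)^2 * g' \<tau> * cnj (h' \<tau>)
      + 2 * \<i> * of_real \<kappa> * of_real (Im \<tau>) * (g' \<tau> * cnj (h \<tau>) - g \<tau> * cnj (h' \<tau>)))"
proof -
  define R where "R = (\<lambda>v::real. v powr \<kappa>)"
  define S where "S = (\<lambda>v::real. v powr \<kappa> * \<kappa> / v)"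
  define S' where "S' = (\<lambda>v::real. v powr \<kappa> * (\<kappa> * (\<kappa> - 1)) / v\<^sup>2)"
  have dR: "(R has_real_derivative S v) (at v)" if "v > 0" for v
    unfolding R_def S_def using that
    by (auto intro!: derivative_eq_intros simp: powr_diff field_simps)
  have dS: "(S has_real_derivative S' v) (at v)" if "v > 0" for v
    unfolding S_def S'_def using that
    by (auto intro!: derivative_eq_intros simp: powr_diff field_simps power2_eq_square)
  note wR = has_wirtinger_Im[OF dR] and wS = has_wirtinger_Im[OF dS]
  have g'': "(g' has_field_derivative deriv g' \<tau>) (at \<tau>)"
    by (rule has_field_derivative_deriv_of_holomorphic[OF open_upper_half]) (use g \<tau> in auto)
  have h'': "(h' has_field_derivative deriv h' \<tau>) (at \<tau>)"
    by (rule has_field_derivative_deriv_of_holomorphic[OF open_upper_half]) (use h \<tau> in auto)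
  define a where "a = (\<lambda>t. g' t * cnj (h t) * of_real (R (Im t)) + g t * cnj (h t) * (- \<i> / 2 * of_real (S (Im t))))"
  define b where "b = (\<lambda>t. g t * cnj (h' t) * of_real (R (Im t)) + g t * cnj (h t) * (\<i> / 2 * of_real (S (Im t))))"
  define ab where "ab = g' \<tau> * cnj (h' \<tau>) * of_real (R (Im \<tau>)) + g' \<tau> * cnj (h \<tau>) * (\<i> / 2 * of_real (S (Im \<tau>)))
     - g \<tau> * cnj (h' \<tau>) * (\<i> / 2 * of_real (S (Im \<tau>))) + g \<tau> * cnj (h \<tau>) * of_real (S' (Im \<tau>)) / 4"
  have f: "has_wirtinger (\<lambda>t. g t * cnj (h t) * of_real (R (Im t))) (a t) (b t) t" if "Im t > 0" for t
    by (rule has_wirtinger_eq[OF has_wirtinger_mult[OF has_wirtinger_mult[OF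
         has_wirtinger_holomorphic[OF g[OF that]] has_wirtinger_cnj[OF h[OF that]]] wR[OF that]]])
       (auto simp: a_def b_def algebra_simps)
  have a1: "has_wirtinger a (deriv g' \<tau> * cnj (h \<tau>) * of_real (R (Im \<tau>)) +
       g' \<tau> * cnj (h \<tau>) * (- \<i> * of_real (S (Im \<tau>))) - g \<tau> * cnj (h \<tau>) * of_real (S' (Im \<tau>)) / 4) ab \<tau>"
    unfolding a_def
    by (rule has_wirtinger_eq[OF has_wirtinger_add[OF
          has_wirtinger_mult[OF has_wirtinger_mult[OF has_wirtinger_holomorphic[OF g''] has_wirtinger_cnj[OF h[OF \<tau>]]] wR[OF \<tau>]]
          has_wirtinger_mult[OF has_wirtinger_mult[OF has_wirtinger_holomorphic[OF g[OF \<tau>]] has_wirtinger_cnj[OF h[OF \<tau>]]]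
            has_wirtinger_mult[OF has_wirtinger_const wS[OF \<tau>]]]]])
       (auto simp: ab_def algebra_simps)
  have b1: "has_wirtinger b ab (g \<tau> * cnj (deriv h' \<tau>) * of_real (R (Im \<tau>)) +
       g \<tau> * cnj (h' \<tau>) * (\<i> * of_real (S (Im \<tau>))) - g \<tau> * cnj (h \<tau>) * of_real (S' (Im \<tau>)) / 4) \<tau>"
    unfolding b_def
    by (rule has_wirtinger_eq[OF has_wirtinger_add[OF
          has_wirtinger_mult[OF has_wirtinger_mult[OF has_wirtinger_holomorphic[OF g[OF \<tau>]] has_wirtinger_cnj[OF h'']] wR[OF \<tau>]]
          has_wirtinger_mult[OF has_wirtinger_mult[OF has_wirtinger_holomorphic[OF g[OF \<tau>]] has_wirtinger_cnj[OF h[OF \<tau>]]]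
            has_wirtinger_mult[OF has_wirtinger_const wS[OF \<tau>]]]]])
       (auto simp: ab_def algebra_simps)
  define v where "v = complex_of_real (Im \<tau>)"
  have v0: "v \<noteq> 0" using \<tau> by (simp add: v_def)
  have lap: "d_re (d_re (\<lambda>t. g t * cnj (h t) * of_real (R (Im t)))) \<tau>
      + d_im (d_im (\<lambda>t. g t * cnj (h t) * of_real (R (Im t)))) \<tau> = 2 * (ab + ab)"
    by (rule laplacian_wirtinger[where a = a and b = b, OF _ a1 b1 \<tau>]) (rule f)
  have "DD \<kappa> (\<lambda>t. g t * cnj (h t) * of_real (R (Im t))) \<tau> = v\<^sup>2 * (2 * (ab + ab))
      - of_real \<kappa> * (of_real \<kappa> - 1) * (g \<tau> * cnj (h \<tau>) * of_real (R (Im \<tau>)))"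
    unfolding DD_def lap by (simp add: v_def)
  also have "\<dots> = of_real (R (Im \<tau>)) * (4 * v^2 * g' \<tau> * cnj (h' \<tau>)
      + 2 * \<i> * of_real \<kappa> * v * (g' \<tau> * cnj (h \<tau>) - g \<tau> * cnj (h' \<tau>)))"
    using v0 unfolding ab_def S_def S'_def R_def
    by (simp add: field_simps power2_eq_square flip: v_def)
  finally show ?thesis unfolding R_def v_def .
qed

section \<open>Theta series and their termwise derivatives\<close>

lemma norm_e: "norm (e w) = exp (- 2 * pi * Im w)"
  by (simp add: e_def)

lemma e_add: "e (a + b) = e a * e b"
  by (simp add: e_def exp_add ring_distribs)

lemma has_field_derivative_e [derivative_intros]:
  assumes "(f has_field_derivative f') (at x within S)"
  shows "((\<lambda>x. e (f x)) has_field_derivative 2 * of_real pi * \<i> * f' * e (f x)) (at x within S)"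
  unfolding e_def by (rule derivative_eq_intros assms refl)+ simp

lemma continuous_on_e [continuous_intros]:
  "continuous_on S f \<Longrightarrow> continuous_on S (\<lambda>x. e (f x))"
  unfolding e_def by (intro continuous_intros)

text \<open>
  The common majorant of all theta series below: \<open>\<alpha>\<close> comes from a lower bound on \<open>Im \<tau>\<close>, \<open>\<beta>\<close> from an upper
  bound on \<open>|Im z|\<close>, and the polynomial factor from differentiation.
\<close>

lemma summable_on_int_gaussian:
  assumes "\<alpha> > 0"
  shows "(\<lambda>r::int. (1 + \<bar>real_of_int r\<bar>) ^ j * exp (- \<alpha> * (real_of_int r)\<^sup>2 + \<beta> * \<bar>real_of_int r\<bar>)) summable_on UNIV"
proof -
  define f where "f = (\<lambda>x::real. (1 + x) ^ j * exp (- \<alpha> * x\<^sup>2 + \<beta> * x))"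
  have "(\<lambda>n. f (real n)) \<in> O(\<lambda>n. 1 / real n ^ 2)"
    unfolding f_def using assms by real_asymp
  then have "summable (\<lambda>n. f (real n))"
    by (rule summable_comparison_test_bigo[rotated])
       (use inverse_power_summable[of 2, where 'a = real] in \<open>simp add: divide_inverse\<close>)
  moreover have f0: "f (real n) \<ge> 0" for n
    by (simp add: f_def)
  ultimately have nat: "(\<lambda>n. f (real n)) summable_on UNIV"
    by (subst summable_on_UNIV_nonneg_real_iff) auto
  have 1: "(\<lambda>r::int. f \<bar>real_of_int r\<bar>) summable_on range int"
    using nat by (subst summable_on_reindex) (auto simp: o_def)
  have 2: "(\<lambda>r::int. f \<bar>real_of_int r\<bar>) summable_on range (\<lambda>n. - int n)"
    using nat by (subst summable_on_reindex) (auto simp: o_def inj_on_def)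
  have UN: "UNIV = range int \<union> range (\<lambda>n. - int n)"
  proof -
    have "r \<in> range int \<union> range (\<lambda>n. - int n)" for r
      by (cases r rule: int_cases2) auto
    then show ?thesis by blast
  qed
  have "(\<lambda>r::int. f \<bar>real_of_int r\<bar>) summable_on UNIV"
    unfolding UN using 1 2 by (rule summable_on_union)
  then show ?thesis
    by (simp add: f_def)
qed

text \<open>
  Weierstrass' theorem: a locally uniform limit of holomorphic functions may be differentiated, here
  along the net of finite subsets of an arbitrary index set.
\<close>

lemma has_sum_termwise_derivative:
  fixes f f' :: "'a \<Rightarrow> complex \<Rightarrow> complex"
  assumes "\<rho> > 0"
    and deriv: "\<And>r x. r \<in> A \<Longrightarrow> x \<in> cball w \<rho> \<Longrightarrow> (f r has_field_derivative f' r x) (at x)"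
    and M: "M summable_on A" "\<And>r x. r \<in> A \<Longrightarrow> x \<in> cball w \<rho> \<Longrightarrow> norm (f r x) \<le> M r"
    and sum: "\<And>x. x \<in> cball w \<rho> \<Longrightarrow> ((\<lambda>r. f r x) has_sum g x) A"
  shows "\<exists>D. (g has_field_derivative D) (at w) \<and> ((\<lambda>r. f' r w) has_sum D) A"
proof -
  have ul: "uniform_limit (cball w \<rho>) (\<lambda>X x. \<Sum>r\<in>X. f r x) g (finite_subsets_at_top A)"
    by (rule Weierstrass_m_test_general'[OF M(2) sum M(1)])
  have ev: "\<forall>\<^sub>F X in finite_subsets_at_top A. continuous_on (cball w \<rho>) (\<lambda>x. \<Sum>r\<in>X. f r x) \<and>
      (\<forall>x\<in>ball w \<rho>. ((\<lambda>x. \<Sum>r\<in>X. f r x) has_field_derivative (\<Sum>r\<in>X. f' r x)) (at x))"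
    unfolding eventually_finite_subsets_at_top
  proof (intro exI[of _ "{}"] conjI allI impI)
    fix X assume "finite X \<and> {} \<subseteq> X \<and> X \<subseteq> A"
    then have X: "r \<in> A" if "r \<in> X" for r using that by auto
    show "continuous_on (cball w \<rho>) (\<lambda>x. \<Sum>r\<in>X. f r x)"
      by (intro continuous_on_sum DERIV_continuous_on[OF has_field_derivative_at_within[OF deriv]]) (use X in auto)
    show "\<forall>x\<in>ball w \<rho>. ((\<lambda>x. \<Sum>r\<in>X. f r x) has_field_derivative (\<Sum>r\<in>X. f' r x)) (at x)"
      using X by (intro ballI DERIV_sum deriv) auto
  qed auto
  obtain g' where "\<And>x. x \<in> ball w \<rho> \<Longrightarrow> (g has_field_derivative g' x) (at x) \<and>
      ((\<lambda>X. \<Sum>r\<in>X. f' r x) \<longlongrightarrow> g' x) (finite_subsets_at_top A)"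
    by (rule has_complex_derivative_uniform_limit[OF ev ul _ \<open>\<rho> > 0\<close>]) (use finite_subsets_at_top_neq_bot in auto)
  from this[of w] show ?thesis
    using \<open>\<rho> > 0\<close> unfolding has_sum_def by auto
qed

text \<open>
  Differentiating a theta series inserts powers of the summation index, so the family is closed under
  both derivatives.
\<close>

definition theta_moment :: "nat \<Rightarrow> int set \<Rightarrow> nat \<Rightarrow> complex \<Rightarrow> complex \<Rightarrow> complex" where
  "theta_moment m A j \<tau> z =
     (\<Sum>\<^sub>\<infinity>r\<in>A. of_int r ^ j * e ((of_int r)\<^sup>2 / (4 * of_nat m) * \<tau> + of_int r * z))"

lemma norm_theta_term_le:
  assumes "m \<ge> 1" "v \<le> Im \<tau>" "\<bar>Im z\<bar> \<le> Y"
  shows "norm (of_int r ^ j * e ((of_int r)\<^sup>2 / (4 * of_nat m) * \<tau> + of_int r * z))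
    \<le> (1 + \<bar>real_of_int r\<bar>) ^ j * exp (- (pi * v / (2 * real m)) * (real_of_int r)\<^sup>2 + 2 * pi * Y * \<bar>real_of_int r\<bar>)"
proof -
  let ?r = "real_of_int r"
  have eq: "(of_int r)\<^sup>2 / (4 * of_nat m) * \<tau> = complex_of_real (?r\<^sup>2 / (4 * real m)) * \<tau>"
    by simp
  have "Im ((of_int r)\<^sup>2 / (4 * of_nat m) * \<tau> + of_int r * z) = ?r\<^sup>2 / (4 * real m) * Im \<tau> + ?r * Im z"
    unfolding eq by simp
  moreover have "?r\<^sup>2 / (4 * real m) * Im \<tau> \<ge> ?r\<^sup>2 / (4 * real m) * v"
    using assms by (intro mult_left_mono) auto
  moreover have "- (?r * Im z) \<le> Y * \<bar>?r\<bar>"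
    using mult_left_mono[OF assms(3), of "\<bar>?r\<bar>"] abs_ge_minus_self[of "?r * Im z"]
    by (simp add: abs_mult mult.commute)
  ultimately have "- Im ((of_int r)\<^sup>2 / (4 * of_nat m) * \<tau> + of_int r * z)
     \<le> Y * \<bar>?r\<bar> - ?r\<^sup>2 / (4 * real m) * v"
    by linarith
  then have le: "2 * pi * - Im ((of_int r)\<^sup>2 / (4 * of_nat m) * \<tau> + of_int r * z)
     \<le> 2 * pi * (Y * \<bar>?r\<bar> - ?r\<^sup>2 / (4 * real m) * v)"
    by (intro mult_left_mono) auto
  have "- 2 * pi * Im ((of_int r)\<^sup>2 / (4 * of_nat m) * \<tau> + of_int r * z)
     = 2 * pi * - Im ((of_int r)\<^sup>2 / (4 * of_nat m) * \<tau> + of_int r * z)"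
    by (simp only: minus_mult_left minus_mult_right)
  also note le
  also have "2 * pi * (Y * \<bar>?r\<bar> - ?r\<^sup>2 / (4 * real m) * v)
     = - (pi * v / (2 * real m)) * ?r\<^sup>2 + 2 * pi * Y * \<bar>?r\<bar>"
    using assms by (simp add: field_simps)
  finally show ?thesis
    unfolding norm_mult norm_e norm_power by (intro mult_mono power_mono) auto
qed

lemma theta_moment_has_sum:
  assumes "m \<ge> 1" "Im \<tau> > 0"
  shows "((\<lambda>r. of_int r ^ j * e ((of_int r)\<^sup>2 / (4 * of_nat m) * \<tau> + of_int r * z))
    has_sum theta_moment m A j \<tau> z) A"
proof -
  have "(\<lambda>r. norm (of_int r ^ j * e ((of_int r)\<^sup>2 / (4 * of_nat m) * \<tau> + of_int r * z))) summable_on A"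
  proof (rule Infinite_Sum.abs_summable_on_comparison_test')
    show "(\<lambda>r. (1 + \<bar>real_of_int r\<bar>) ^ j * exp (- (pi * Im \<tau> / (2 * real m)) * (real_of_int r)\<^sup>2
       + 2 * pi * \<bar>Im z\<bar> * \<bar>real_of_int r\<bar>)) summable_on A"
      by (rule summable_on_subset_banach[OF summable_on_int_gaussian]) (use assms in auto)
  qed (rule norm_theta_term_le; use assms in simp)
  then show ?thesis
    unfolding theta_moment_def by (rule has_sum_infsum[OF Infinite_Sum.abs_summable_summable])
qed

lemma theta_moment_deriv_z:
  assumes "m \<ge> 1" "Im \<tau> > 0"
  shows "((\<lambda>z. theta_moment m A j \<tau> z) has_field_derivative 2 * of_real pi * \<i> * theta_moment m A (j + 1) \<tau> z) (at z)"
proof -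
  have ex: "\<exists>D. ((\<lambda>z. theta_moment m A j \<tau> z) has_field_derivative D) (at z) \<and>
     ((\<lambda>r. 2 * of_real pi * \<i> * (of_int r ^ (j + 1) * e ((of_int r)\<^sup>2 / (4 * of_nat m) * \<tau> + of_int r * z))) has_sum D) A"
  proof (rule has_sum_termwise_derivative[where \<rho> = 1])
    show "((\<lambda>z. of_int r ^ j * e ((of_int r)\<^sup>2 / (4 * of_nat m) * \<tau> + of_int r * z)) has_field_derivative
       2 * of_real pi * \<i> * (of_int r ^ (j + 1) * e ((of_int r)\<^sup>2 / (4 * of_nat m) * \<tau> + of_int r * x))) (at x)" for r x
    proof -
      have "((\<lambda>z. (of_int r)\<^sup>2 / (4 * of_nat m) * \<tau> + of_int r * z) has_field_derivative of_int r) (at x)"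
        by (auto intro!: derivative_eq_intros)
      from DERIV_cmult[OF has_field_derivative_e[OF this], of "of_int r ^ j"] show ?thesis
        by (simp add: mult_ac)
    qed
    show "(\<lambda>r. (1 + \<bar>real_of_int r\<bar>) ^ j * exp (- (pi * Im \<tau> / (2 * real m)) * (real_of_int r)\<^sup>2
       + 2 * pi * (\<bar>Im z\<bar> + 1) * \<bar>real_of_int r\<bar>)) summable_on A"
      by (rule summable_on_subset_banach[OF summable_on_int_gaussian]) (use assms in auto)
  next
    fix r x assume "x \<in> cball z 1"
    then have "\<bar>Im x - Im z\<bar> \<le> 1"
      using abs_Im_le_cmod[of "x - z"] by (auto simp: dist_norm norm_minus_commute)
    then show "norm (of_int r ^ j * e ((of_int r)\<^sup>2 / (4 * of_nat m) * \<tau> + of_int r * x)) \<le>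
     (1 + \<bar>real_of_int r\<bar>) ^ j * exp (- (pi * Im \<tau> / (2 * real m)) * (real_of_int r)\<^sup>2
       + 2 * pi * (\<bar>Im z\<bar> + 1) * \<bar>real_of_int r\<bar>)"
      using assms by (intro norm_theta_term_le) auto
  qed (use assms theta_moment_has_sum in auto)
  have sum: "((\<lambda>r. 2 * of_real pi * \<i> * (of_int r ^ (j + 1) * e ((of_int r)\<^sup>2 / (4 * of_nat m) * \<tau> + of_int r * z)))
    has_sum 2 * of_real pi * \<i> * theta_moment m A (j + 1) \<tau> z) A"
    by (intro has_sum_cmult_right theta_moment_has_sum assms)
  show ?thesis
    using ex has_sum_unique[OF _ sum] by fast
qed

lemma theta_moment_deriv_tau:
  assumes "m \<ge> 1" "Im \<tau> > 0"
  shows "((\<lambda>t. theta_moment m A j t z) has_field_derivative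
     2 * of_real pi * \<i> / (4 * of_nat m) * theta_moment m A (j + 2) \<tau> z) (at \<tau>)"
proof -
  have ex: "\<exists>D. ((\<lambda>t. theta_moment m A j t z) has_field_derivative D) (at \<tau>) \<and>
     ((\<lambda>r. 2 * of_real pi * \<i> / (4 * of_nat m) * (of_int r ^ (j + 2) * e ((of_int r)\<^sup>2 / (4 * of_nat m) * \<tau> + of_int r * z))) has_sum D) A"
  proof (rule has_sum_termwise_derivative[where \<rho> = "Im \<tau> / 2"])
    show "((\<lambda>t. of_int r ^ j * e ((of_int r)\<^sup>2 / (4 * of_nat m) * t + of_int r * z)) has_field_derivative
       2 * of_real pi * \<i> / (4 * of_nat m) * (of_int r ^ (j + 2) * e ((of_int r)\<^sup>2 / (4 * of_nat m) * x + of_int r * z))) (at x)" for r x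
    proof -
      have d: "((\<lambda>t. (of_int r)\<^sup>2 / (4 * of_nat m) * t + of_int r * z) has_field_derivative (of_int r)\<^sup>2 / (4 * of_nat m)) (at x)"
        by (rule DERIV_cong[OF DERIV_add[OF DERIV_cmult[OF DERIV_ident] DERIV_const]]) simp
      have eq: "R ^ j * (2 * P * \<i> * (R\<^sup>2 / (4 * M)) * E) = 2 * P * \<i> / (4 * M) * (R ^ (j + 2) * E)"
        for R P M E :: complex
        by (simp add: power_add power2_eq_square)
      show ?thesis
        by (rule DERIV_cong[OF DERIV_cmult[OF has_field_derivative_e[OF d]] eq])
    qed
    show "(\<lambda>r. (1 + \<bar>real_of_int r\<bar>) ^ j * exp (- (pi * (Im \<tau> / 2) / (2 * real m)) * (real_of_int r)\<^sup>2
       + 2 * pi * \<bar>Im z\<bar> * \<bar>real_of_int r\<bar>)) summable_on A"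
      by (rule summable_on_subset_banach[OF summable_on_int_gaussian]) (use assms in auto)
    have im: "Im \<tau> / 2 \<le> Im x" if "x \<in> cball \<tau> (Im \<tau> / 2)" for x
      using that abs_Im_le_cmod[of "x - \<tau>"] by (auto simp: dist_norm norm_minus_commute)
    then show "norm (of_int r ^ j * e ((of_int r)\<^sup>2 / (4 * of_nat m) * x + of_int r * z)) \<le>
     (1 + \<bar>real_of_int r\<bar>) ^ j * exp (- (pi * (Im \<tau> / 2) / (2 * real m)) * (real_of_int r)\<^sup>2
       + 2 * pi * \<bar>Im z\<bar> * \<bar>real_of_int r\<bar>)" if "x \<in> cball \<tau> (Im \<tau> / 2)" for r x
      using assms that by (intro norm_theta_term_le) auto
    show "((\<lambda>r. of_int r ^ j * e ((of_int r)\<^sup>2 / (4 * of_nat m) * x + of_int r * z)) has_sum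
         theta_moment m A j x z) A" if "x \<in> cball \<tau> (Im \<tau> / 2)" for x
      using im[OF that] assms by (intro theta_moment_has_sum) auto
  qed (use assms in auto)
  have sum: "((\<lambda>r. 2 * of_real pi * \<i> / (4 * of_nat m) * (of_int r ^ (j + 2) * e ((of_int r)\<^sup>2 / (4 * of_nat m) * \<tau> + of_int r * z)))
    has_sum 2 * of_real pi * \<i> / (4 * of_nat m) * theta_moment m A (j + 2) \<tau> z) A"
    by (intro has_sum_cmult_right theta_moment_has_sum assms)
  show ?thesis
    using ex has_sum_unique[OF _ sum] by fast
qed

section \<open>Fourier series on the unit interval\<close>

text \<open>
  A series with a summable majorant converges uniformly, hence may be integrated termwise.
\<close>

lemma has_sum_integral:
  fixes f :: "'i \<Rightarrow> real \<Rightarrow> complex"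
  assumes "\<And>i. i \<in> I \<Longrightarrow> continuous_on {a..b} (f i)"
    and "\<And>i x. i \<in> I \<Longrightarrow> x \<in> {a..b} \<Longrightarrow> norm (f i x) \<le> M i" "M summable_on I"
    and "\<And>x. x \<in> {a..b} \<Longrightarrow> ((\<lambda>i. f i x) has_sum g x) I"
  shows "continuous_on {a..b} g" "((\<lambda>i. integral {a..b} (f i)) has_sum integral {a..b} g) I"
proof -
  have ul: "uniform_limit {a..b} (\<lambda>X x. \<Sum>i\<in>X. f i x) g (finite_subsets_at_top I)"
    by (rule Weierstrass_m_test_general'[OF assms(2,4,3)])
  have X: "continuous_on {a..b} (\<lambda>x. \<Sum>i\<in>X. f i x)" if "X \<subseteq> I" for X
    using that assms(1) by (intro continuous_on_sum) auto
  have ev: "\<forall>\<^sub>F X in finite_subsets_at_top I. X \<subseteq> I \<and> finite X"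
    unfolding eventually_finite_subsets_at_top by (intro exI[of _ "{}"]) auto
  show cont: "continuous_on {a..b} g"
    by (rule uniform_limit_theorem[OF eventually_mono[OF ev] ul]) (use X in auto)
  have ul': "uniform_limit (cbox a b) (\<lambda>X x. if X \<subseteq> I then \<Sum>i\<in>X. f i x else 0) g (finite_subsets_at_top I)"
  proof -
    have "\<forall>\<^sub>F X in finite_subsets_at_top I. \<forall>x\<in>{a..b}. (\<Sum>i\<in>X. f i x) = (if X \<subseteq> I then \<Sum>i\<in>X. f i x else 0)"
      using ev by (rule eventually_mono) auto
    from iffD1[OF uniform_limit_cong[OF this refl] ul] show ?thesis by simp
  qed
  have cont': "continuous_on (cbox a b) (\<lambda>x. if Y \<subseteq> I then \<Sum>i\<in>Y. f i x else 0)" for Y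
    using X[of Y] by (cases "Y \<subseteq> I") auto
  obtain J K where J: "\<And>X. ((\<lambda>x. if X \<subseteq> I then \<Sum>i\<in>X. f i x else 0) has_integral J X) (cbox a b)"
      "(g has_integral K) (cbox a b)" "(J \<longlongrightarrow> K) (finite_subsets_at_top I)"
    by (rule uniform_limit_integral_cbox[OF ul' cont' finite_subsets_at_top_neq_bot]) (rule that, assumption+)
  have "J X = (\<Sum>i\<in>X. integral {a..b} (f i))" if "X \<subseteq> I \<and> finite X" for X
  proof -
    have "((\<lambda>x. \<Sum>i\<in>X. f i x) has_integral J X) (cbox a b)"
      using J(1)[of X] that by simp
    moreover have "((\<lambda>x. \<Sum>i\<in>X. f i x) has_integral (\<Sum>i\<in>X. integral {a..b} (f i))) (cbox a b)"
      using that by (intro has_integral_sum) (auto intro!: integrable_integral integrable_continuous_interval assms(1))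
    ultimately show ?thesis by (rule has_integral_unique)
  qed
  then have "((\<lambda>X. \<Sum>i\<in>X. integral {a..b} (f i)) \<longlongrightarrow> K) (finite_subsets_at_top I)"
    by (intro Lim_transform_eventually[OF J(3)] eventually_mono[OF ev]) auto
  then show "((\<lambda>i. integral {a..b} (f i)) has_sum integral {a..b} g) I"
    unfolding has_sum_def using J(2) by (simp add: integral_unique)
qed

lemma integral_e_of_int:
  "integral {0..1} (\<lambda>x. e (of_int n * of_real x)) = (if n = 0 then 1 else 0)"
proof (cases "n = 0")
  case True
  then show ?thesis by (simp add: e_def)
next
  case False
  have "((\<lambda>x. e (of_int n * of_real x)) has_integral
      (e (of_int n * of_real 1) / (2 * of_real pi * \<i> * of_int n) - e (of_int n * of_real 0) / (2 * of_real pi * \<i> * of_int n))) {0..1}"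
    by (rule fundamental_theorem_of_calculus)
       (use False in \<open>auto intro!: derivative_eq_intros has_vector_derivative_real_field\<close>)
  moreover have "e (of_int n) = 1"
    unfolding e_def using exp_two_pi_i exp_integer_2pi[of "of_int n"] by (simp add: mult_ac)
  ultimately show ?thesis
    using False by (simp add: integral_unique e_def)
qed

lemma norm_e_of_real [simp]: "norm (e (of_int n * of_real x)) = 1"
  by (simp add: norm_e)

lemma cnj_e_real: "cnj (e (of_int n * of_real x)) = e (- (of_int n * of_real x))"
  by (simp add: e_def exp_cnj)

lemma fourier_series_multiply_integral:
  fixes c :: "'i \<Rightarrow> complex" and \<nu> :: "'i \<Rightarrow> int"
  assumes sum: "\<And>x::real. ((\<lambda>i. c i * e (of_int (\<nu> i) * of_real x)) has_sum \<Phi> x) I"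
    and w: "continuous_on {0..1} w"
  shows "((\<lambda>i. c i * integral {0..1} (\<lambda>x. e (of_int (\<nu> i) * of_real x) * w x)) has_sum
     integral {0..1} (\<lambda>x. \<Phi> x * w x)) I" "continuous_on {0..1} (\<lambda>x. \<Phi> x * w x)"
proof -
  have "(\<lambda>i. norm (c i * e (of_int (\<nu> i) * of_real 0))) summable_on I"
    using has_sum_imp_summable[OF sum[of 0]] unfolding summable_on_iff_abs_summable_on_complex .
  then have c: "(\<lambda>i. norm (c i)) summable_on I"
    by (simp add: e_def)
  have "bounded (w ` {0..1})"
    by (rule compact_imp_bounded[OF compact_continuous_image[OF w compact_Icc]])
  then obtain K where K: "\<And>x. x \<in> {0..1} \<Longrightarrow> norm (w x) \<le> K"
    unfolding bounded_iff by blast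
  note * = has_sum_integral[of I 0 1 "\<lambda>i x. c i * (e (of_int (\<nu> i) * of_real x) * w x)" "\<lambda>i. norm (c i) * K"]
  have 1: "continuous_on {0..1} (\<lambda>x. c i * (e (of_int (\<nu> i) * complex_of_real x) * w x))" for i
    by (intro continuous_intros w)
  have 2: "norm (c i * (e (of_int (\<nu> i) * complex_of_real x) * w x)) \<le> norm (c i) * K" if "x \<in> {0..1}" for i x
    using K[OF that] by (simp add: norm_mult mult_left_mono)
  have 3: "(\<lambda>i. norm (c i) * K) summable_on I"
    using c by (rule summable_on_cmult_left)
  have 4: "((\<lambda>i. c i * (e (of_int (\<nu> i) * complex_of_real x) * w x)) has_sum \<Phi> x * w x) I" for x
    using has_sum_cmult_left[OF sum[of x], of "w x"] by (simp add: mult.assoc)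
  show "continuous_on {0..1} (\<lambda>x. \<Phi> x * w x)"
    by (rule *(1)[OF 1 2 3 4])
  have "((\<lambda>i. integral {0..1} (\<lambda>x. c i * (e (of_int (\<nu> i) * of_real x) * w x))) has_sum
     integral {0..1} (\<lambda>x. \<Phi> x * w x)) I"
    by (rule *(2)[OF 1 2 3 4])
  then show "((\<lambda>i. c i * integral {0..1} (\<lambda>x. e (of_int (\<nu> i) * of_real x) * w x)) has_sum
     integral {0..1} (\<lambda>x. \<Phi> x * w x)) I"
    by simp
qed

text \<open>
  The index set and the frequency \<open>\<nu>\<close> are kept apart because the expansion of a Jacobi form at the cusp
  runs over pairs \<open>(n, r)\<close>, of which only \<open>r\<close> is a frequency in \<open>z\<close>.
\<close>

lemma fourier_coefficient:
  fixes c :: "'i \<Rightarrow> complex" and \<nu> :: "'i \<Rightarrow> int"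
  assumes sum: "\<And>x::real. ((\<lambda>i. c i * e (of_int (\<nu> i) * of_real x)) has_sum \<Phi> x) I"
  shows "((\<lambda>i. if \<nu> i = r then c i else 0) has_sum
     integral {0..1} (\<lambda>x. \<Phi> x * e (- (of_int r * of_real x)))) I"
proof -
  have "((\<lambda>i. c i * integral {0..1} (\<lambda>x. e (of_int (\<nu> i) * of_real x) * e (- (of_int r * of_real x)))) has_sum
     integral {0..1} (\<lambda>x. \<Phi> x * e (- (of_int r * of_real x)))) I"
    by (rule fourier_series_multiply_integral[OF sum]) (intro continuous_intros)
  also have "(\<lambda>i. c i * integral {0..1} (\<lambda>x. e (of_int (\<nu> i) * of_real x) * e (- (of_int r * of_real x))))
     = (\<lambda>i. if \<nu> i = r then c i else 0)"
  proof
    fix i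
    have "(\<lambda>x. e (of_int (\<nu> i) * of_real x) * e (- (of_int r * of_real x))) = (\<lambda>x. e (of_int (\<nu> i - r) * of_real x))"
      by (simp add: algebra_simps flip: e_add)
    then show "c i * integral {0..1} (\<lambda>x. e (of_int (\<nu> i) * of_real x) * e (- (of_int r * of_real x)))
       = (if \<nu> i = r then c i else 0)"
      using integral_e_of_int[of "\<nu> i - r"] by simp
  qed
  finally show ?thesis .
qed

text \<open>
  Integrate the first series termwise against the conjugate of the second, whose integrals against the
  exponentials are its own coefficients.  Absolute convergence replaces the usual theory in \<open>L\<^sup>2\<close>.
\<close>

lemma parseval:
  fixes a b :: "int \<Rightarrow> complex"
  assumes a: "\<And>x::real. ((\<lambda>r. a r * e (of_int r * of_real x)) has_sum \<Phi> x) UNIV"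
    and b: "\<And>x::real. ((\<lambda>r. b r * e (of_int r * of_real x)) has_sum \<Psi> x) UNIV"
  shows "((\<lambda>r. a r * cnj (b r)) has_sum integral {0..1} (\<lambda>x. \<Phi> x * cnj (\<Psi> x))) UNIV"
    "continuous_on {0..1} (\<lambda>x. \<Phi> x * cnj (\<Psi> x))"
proof -
  have "continuous_on {0..1} \<Psi>"
    using fourier_series_multiply_integral(2)[OF b, of "\<lambda>x. 1"] by simp
  then have w: "continuous_on {0..1} (\<lambda>x. cnj (\<Psi> x))"
    by (intro continuous_intros)
  have coeff: "integral {0..1} (\<lambda>x. e (of_int r * of_real x) * cnj (\<Psi> x)) = cnj (b r)" for r
  proof -
    have "((\<lambda>s. if s = r then b s else 0) has_sum integral {0..1} (\<lambda>x. \<Psi> x * e (- (of_int r * of_real x)))) UNIV"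
      by (rule fourier_coefficient[OF b])
    moreover have "((\<lambda>s. if s = r then b s else 0) has_sum b r) UNIV"
      by (rule has_sum_finite_neutralI[of "{r}"]) auto
    ultimately have "integral {0..1} (\<lambda>x. \<Psi> x * e (- (of_int r * of_real x))) = b r"
      by (rule has_sum_unique)
    moreover have "(\<lambda>x. e (of_int r * of_real x) * cnj (\<Psi> x)) = (\<lambda>x. cnj (\<Psi> x * e (- (of_int r * of_real x))))"
      unfolding complex_cnj_mult cnj_e_real[symmetric] complex_cnj_cnj by (simp only: mult.commute)
    ultimately show ?thesis
      by (simp only: Henstock_Kurzweil_Integration.integral_cnj[symmetric])
  qed
  show "((\<lambda>r. a r * cnj (b r)) has_sum integral {0..1} (\<lambda>x. \<Phi> x * cnj (\<Psi> x))) UNIV"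
    using fourier_series_multiply_integral(1)[OF a w] unfolding coeff .
  show "continuous_on {0..1} (\<lambda>x. \<Phi> x * cnj (\<Psi> x))"
    by (rule fourier_series_multiply_integral(2)[OF a w])
qed

section \<open>Integrals over a fibre, unfolding and Gaussian moments\<close>

text \<open>
  The link that gives access to Fubini's theorem in the coordinates \<open>x\<close> and \<open>y\<close>.
\<close>

lemma lborel_complex_eq:
  "(lborel :: complex measure) = distr (lborel \<Otimes>\<^sub>M lborel) borel (\<lambda>(x, y). Complex x y)"
proof (rule lborel_eqI)
  fix l u :: complex
  assume le: "\<And>b. b \<in> Basis \<Longrightarrow> l \<bullet> b \<le> u \<bullet> b"
  have [measurable]: "(\<lambda>(x, y). Complex x y) \<in> borel_measurable (lborel \<Otimes>\<^sub>M lborel)"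
    unfolding Complex_eq case_prod_beta by measurable
  have "emeasure (distr (lborel \<Otimes>\<^sub>M lborel) borel (\<lambda>(x, y). Complex x y)) (box l u)
     = emeasure (lborel \<Otimes>\<^sub>M lborel) ({Re l<..<Re u} \<times> {Im l<..<Im u})"
    by (subst emeasure_distr)
       (auto simp: in_box_complex_iff space_pair_measure intro!: arg_cong[where f = "emeasure _"])
  also have "\<dots> = ennreal (Re u - Re l) * ennreal (Im u - Im l)"
    using le[of 1] le[of \<i>]
    by (subst lborel.emeasure_pair_measure_Times) (auto simp: Basis_complex_def)
  also have "\<dots> = (\<Prod>b\<in>Basis. (u - l) \<bullet> b)"
    using le[of 1] le[of \<i>] by (simp add: Basis_complex_def ennreal_mult)
  finally show "emeasure (distr (lborel \<Otimes>\<^sub>M lborel) borel (\<lambda>(x, y). Complex x y)) (box l u)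
     = (\<Prod>b\<in>Basis. (u - l) \<bullet> b)" .
qed simp

lemma integrable_lborel_complex_product:
  fixes a b :: "real \<Rightarrow> real"
  assumes "integrable lborel a" "integrable lborel b"
  shows "integrable (lborel :: complex measure) (\<lambda>z. a (Re z) * b (Im z))"
proof -
  have [measurable]: "(\<lambda>(x, y). Complex x y) \<in> borel_measurable (lborel \<Otimes>\<^sub>M lborel)"
    unfolding Complex_eq case_prod_beta by measurable
  have [measurable]: "a \<in> borel_measurable borel" "b \<in> borel_measurable borel"
    using assms[THEN borel_measurable_integrable] by auto
  have "integrable (lborel \<Otimes>\<^sub>M lborel) (\<lambda>(x, y). a x * b y)"
    using assms by (intro lborel_pair.Fubini_integrable) (auto simp: abs_mult)
  then show ?thesis
    unfolding lborel_complex_eq by (subst integrable_distr_eq) (auto simp: case_prod_beta')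
qed

lemma fibre_subset_cbox: "fibre \<tau> \<subseteq> cbox 0 (Complex 1 (Im \<tau>))"
  by (auto simp: fibre_def in_cbox_complex_iff)

lemma fibre_sets [measurable]: "fibre \<tau> \<in> sets borel"
  unfolding fibre_def by measurable

lemma set_integrable_fibre:
  assumes "continuous_on UNIV (f :: complex \<Rightarrow> complex)"
  shows "set_integrable lborel (fibre \<tau>) f"
proof (rule set_integrable_subset)
  show "set_integrable lborel (cbox 0 (Complex 1 (Im \<tau>))) f"
    unfolding set_integrable_def
    by (intro borel_integrable_compact compact_cbox continuous_on_subset[OF assms]) auto
qed (use fibre_subset_cbox in auto)

lemma LINT_half_open_eq_integral:
  fixes f :: "real \<Rightarrow> complex"
  assumes "continuous_on {a..b} f"
  shows "(LINT x:{a..<b}|lborel. f x) = integral {a..b} f"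
proof -
  have "(LINT x:{a..<b}|lborel. f x) = (LINT x:{a..b}|lborel. f x)"
    unfolding set_lebesgue_integral_def
  proof (rule integral_cong_AE)
    have "(\<lambda>x. indicator {a..b} x *\<^sub>R f x) \<in> borel_measurable lborel"
      using borel_integrable_atLeastAtMost'[OF assms] by (auto simp: set_integrable_def)
    moreover from this have "(\<lambda>x. indicator {a..<b} x *\<^sub>R (indicator {a..b} x *\<^sub>R f x)) \<in> borel_measurable lborel"
      by measurable
    moreover have "(\<lambda>x. indicator {a..<b} x *\<^sub>R (indicator {a..b} x *\<^sub>R f x)) = (\<lambda>x. indicator {a..<b} x *\<^sub>R f x)"
      by (auto simp: fun_eq_iff indicator_def)
    ultimately show "(\<lambda>x. indicator {a..<b} x *\<^sub>R f x) \<in> borel_measurable lborel"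
      "(\<lambda>x. indicator {a..b} x *\<^sub>R f x) \<in> borel_measurable lborel" by auto
    show "AE x in lborel. indicator {a..<b} x *\<^sub>R f x = indicator {a..b} x *\<^sub>R f x"
      using AE_lborel_singleton[of b] by eventually_elim (auto simp: indicator_def)
  qed
  also have "\<dots> = integral {a..b} f"
    by (rule set_borel_integral_eq_integral(2)[OF borel_integrable_atLeastAtMost'[OF assms]])
  finally show ?thesis .
qed

lemma LINT_fibre_eq_iterated:
  fixes f :: "complex \<Rightarrow> complex"
  assumes f: "continuous_on UNIV f"
    and I: "continuous_on {0..Im \<tau>} (\<lambda>y. integral {0..1} (\<lambda>x. f (Complex x y)))"
  shows "(LINT z:fibre \<tau>|lborel. f z) = integral {0..Im \<tau>} (\<lambda>y. integral {0..1} (\<lambda>x. f (Complex x y)))"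
proof -
  let ?T = "\<lambda>(x, y). Complex x y"
  have [measurable]: "?T \<in> borel_measurable (lborel \<Otimes>\<^sub>M lborel)"
    unfolding Complex_eq case_prod_beta by measurable
  have [measurable]: "f \<in> borel_measurable borel"
    using f by (rule borel_measurable_continuous_onI)
  have int: "integrable (distr (lborel \<Otimes>\<^sub>M lborel) borel ?T) (\<lambda>z. indicator (fibre \<tau>) z *\<^sub>R f z)"
    using set_integrable_fibre[OF f, of \<tau>] unfolding set_integrable_def lborel_complex_eq .
  have "(LINT z:fibre \<tau>|lborel. f z)
     = integral\<^sup>L (lborel \<Otimes>\<^sub>M lborel) (\<lambda>(x, y). indicator (fibre \<tau>) (Complex x y) *\<^sub>R f (Complex x y))"
    unfolding set_lebesgue_integral_def
    by (subst lborel_complex_eq, subst integral_distr) (simp_all add: case_prod_beta')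
  also have "\<dots> = (LINT y|lborel. LINT x|lborel. indicator (fibre \<tau>) (Complex x y) *\<^sub>R f (Complex x y))"
    using int by (subst lborel_pair.integral_snd) (auto simp: integrable_distr_eq case_prod_beta')
  also have "\<dots> = (LINT y|lborel. indicator {0..<Im \<tau>} y *\<^sub>R (LINT x:{0..<1}|lborel. f (Complex x y)))"
  proof (intro Bochner_Integration.integral_cong refl)
    fix y :: real
    have "(\<lambda>x. indicator (fibre \<tau>) (Complex x y) *\<^sub>R f (Complex x y))
       = (\<lambda>x. indicator {0..<Im \<tau>} y *\<^sub>R indicator {0..<1} x *\<^sub>R f (Complex x y))"
      by (auto simp: fun_eq_iff fibre_def indicator_def)
    then show "(LINT x|lborel. indicator (fibre \<tau>) (Complex x y) *\<^sub>R f (Complex x y))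
       = indicator {0..<Im \<tau>} y *\<^sub>R (LINT x:{0..<1}|lborel. f (Complex x y))"
      by (simp only: set_lebesgue_integral_def integral_scaleR_right)
  qed
  also have "\<dots> = (LINT y:{0..<Im \<tau>}|lborel. integral {0..1} (\<lambda>x. f (Complex x y)))"
    unfolding set_lebesgue_integral_def[of _ "{0..<Im \<tau>}"]
    by (subst LINT_half_open_eq_integral)
       (auto intro!: continuous_on_compose2[OF f] continuous_intros simp: Complex_eq)
  also have "\<dots> = integral {0..Im \<tau>} (\<lambda>y. integral {0..1} (\<lambda>x. f (Complex x y)))"
    using I by (rule LINT_half_open_eq_integral)
  finally show ?thesis .
qed

lemma has_sum_int_imp_symmetric_tendsto:
  fixes f :: "int \<Rightarrow> 'a :: {comm_monoid_add, topological_space}"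
  assumes "(f has_sum S) UNIV"
  shows "(\<lambda>N. \<Sum>l\<in>{- int N..<int N}. f l) \<longlonglongrightarrow> S"
proof -
  have "filterlim (\<lambda>N. {- int N..<int N}) (finite_subsets_at_top UNIV) sequentially"
    unfolding filterlim_finite_subsets_at_top
  proof (intro allI impI)
    fix X :: "int set" assume X: "finite X \<and> X \<subseteq> UNIV"
    show "\<forall>\<^sub>F N in sequentially. finite {- int N..<int N} \<and> X \<subseteq> {- int N..<int N} \<and> {- int N..<int N} \<subseteq> UNIV"
    proof (cases "X = {}")
      case False
      define B where "B = Max ((\<lambda>x. \<bar>x\<bar>) ` X)"
      have "\<bar>x\<bar> \<le> B" if "x \<in> X" for x
        unfolding B_def using X that by (intro Max_ge) auto
      then show ?thesis
        by (intro eventually_sequentiallyI[of "nat (B + 1)"]) fastforce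
    qed auto
  qed
  then show ?thesis
    using assms unfolding has_sum_def by (rule filterlim_compose[rotated])
qed

text \<open>
  The intervals from \<open>s + l\<close> to \<open>s + l + 1\<close> tile the line.  Since the sum is already known to converge, it
  may be computed along the symmetric partial sums, whose intervals exhaust the line.
\<close>

lemma unfold_periodisation:
  fixes f :: "real \<Rightarrow> complex"
  assumes cont: "continuous_on UNIV f" and int: "integrable lborel f" and v: "v > 0"
    and sum: "((\<lambda>l. integral {0..v} (\<lambda>y. f (s + of_int l + y / v))) has_sum S) UNIV"
  shows "S = of_real v * (LINT t|lborel. f t)"
proof -
  have fint: "f integrable_on {a..b}" for a b
    by (intro integrable_continuous_interval continuous_on_subset[OF cont]) auto
  have step: "integral {0..v} (\<lambda>y. f (s + of_int l + y / v))
     = of_real v * integral {s + of_int l..s + of_int (l + 1)} f" for l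
  proof -
    have "((\<lambda>y. f ((1 / v) *\<^sub>R y + (s + of_int l))) has_integral
        (1 / \<bar>1 / v\<bar> ^ DIM(real)) *\<^sub>R integral (cbox (s + of_int l) (s + of_int (l + 1))) f)
        ((\<lambda>x. (1 / (1 / v)) *\<^sub>R x + - ((1 / (1 / v)) *\<^sub>R (s + of_int l))) ` cbox (s + of_int l) (s + of_int (l + 1)))"
      by (rule has_integral_affinity) (use v fint in auto)
    moreover have "(\<lambda>x. (1 / (1 / v)) *\<^sub>R x + - ((1 / (1 / v)) *\<^sub>R (s + of_int l))) ` cbox (s + of_int l) (s + of_int (l + 1)) = {0..v}"
      using v image_affinity_atLeastAtMost[of v "- (v * (s + of_int l))" "s + of_int l" "s + of_int (l + 1)"]
      by (simp add: algebra_simps)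
    ultimately show ?thesis
      using v by (simp add: integral_unique scaleR_conv_of_real algebra_simps)
  qed
  have partial: "(\<Sum>l\<in>{- int N..<int N}. integral {s + of_int l..s + of_int (l + 1)} f)
     = integral {s - real N..s + real N} f" for N
  proof (induction N)
    case (Suc N)
    have "{- int (Suc N)..<int (Suc N)} = insert (- int N - 1) (insert (int N) {- int N..<int N})"
      by auto
    then have "(\<Sum>l\<in>{- int (Suc N)..<int (Suc N)}. integral {s + of_int l..s + of_int (l + 1)} f)
       = integral {s - real N - 1..s - real N} f + integral {s - real N..s + real N} f
         + integral {s + real N..s + real N + 1} f"
      using Suc by (simp add: algebra_simps)
    also have "integral {s - real N - 1..s - real N} f + integral {s - real N..s + real N} f
       = integral {s - real N - 1..s + real N} f"
      by (rule Henstock_Kurzweil_Integration.integral_combine) (auto intro: fint)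
    also have "integral {s - real N - 1..s + real N} f + integral {s + real N..s + real N + 1} f
       = integral {s - real N - 1..s + real N + 1} f"
      by (rule Henstock_Kurzweil_Integration.integral_combine) (auto intro: fint)
    finally show ?case by (simp add: algebra_simps)
  qed auto
  have "(\<lambda>N. \<Sum>l\<in>{- int N..<int N}. integral {0..v} (\<lambda>y. f (s + of_int l + y / v))) \<longlonglongrightarrow> S"
    by (rule has_sum_int_imp_symmetric_tendsto[OF sum])
  then have 1: "(\<lambda>N. of_real v * integral {s - real N..s + real N} f) \<longlonglongrightarrow> S"
    unfolding step sum_distrib_left[symmetric] partial .
  have "(\<lambda>N. LINT t|lborel. indicator {s - real N..s + real N} t *\<^sub>R f t) \<longlonglongrightarrow> (LINT t|lborel. f t)"
  proof (rule integral_dominated_convergence[where w = "\<lambda>t. norm (f t)"])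
    show "f \<in> borel_measurable lborel" "integrable lborel (\<lambda>t. norm (f t))" using int by auto
    then show "(\<lambda>t. indicator {s - real N..s + real N} t *\<^sub>R f t) \<in> borel_measurable lborel" for N
      by measurable
    show "AE t in lborel. (\<lambda>N. indicator {s - real N..s + real N} t *\<^sub>R f t) \<longlonglongrightarrow> f t"
    proof (rule AE_I2)
      fix t
      have "\<forall>\<^sub>F N in sequentially. indicator {s - real N..s + real N} t *\<^sub>R f t = f t"
        using eventually_ge_at_top[of "nat \<lceil>\<bar>t - s\<bar>\<rceil>"]
        by eventually_elim (auto simp: indicator_def nat_ceiling_le_eq)
      then show "(\<lambda>N. indicator {s - real N..s + real N} t *\<^sub>R f t) \<longlonglongrightarrow> f t"
        by (rule tendsto_eventually)
    qed
  qed (auto simp: indicator_def)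
  moreover have "(LINT t|lborel. indicator {s - real N..s + real N} t *\<^sub>R f t) = integral {s - real N..s + real N} f" for N
    using set_borel_integral_eq_integral(2)[OF borel_integrable_atLeastAtMost'[OF continuous_on_subset[OF cont]]]
    by (simp add: set_lebesgue_integral_def)
  ultimately have "(\<lambda>N. of_real v * integral {s - real N..s + real N} f) \<longlonglongrightarrow> of_real v * (LINT t|lborel. f t)"
    by (intro tendsto_mult_left) simp
  then show ?thesis
    using 1 LIMSEQ_unique by blast
qed

text \<open>
  The even central moments of the normal distribution of variance \<open>1 / (2 \<alpha>)\<close>, without its normalising
  factor.
\<close>

lemma gaussian_moment:
  fixes \<alpha> :: real
  assumes "\<alpha> > 0"
  shows "has_bochner_integral lborel (\<lambda>t. t ^ (2 * j) * exp (- \<alpha> * t\<^sup>2))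
     (sqrt (pi / \<alpha>) * (fact (2 * j) / ((4 * \<alpha>) ^ j * fact j)))"
proof -
  define \<sigma> where "\<sigma> = 1 / sqrt (2 * \<alpha>)"
  have \<sigma>: "\<sigma> > 0" "\<sigma>\<^sup>2 = 1 / (2 * \<alpha>)"
    using assms by (auto simp: \<sigma>_def power_divide)
  have "has_bochner_integral lborel (\<lambda>x. normal_density 0 \<sigma> x * (x - 0) ^ (2 * j))
     (fact (2 * j) / ((2 / \<sigma>\<^sup>2) ^ j * fact j))"
    by (rule normal_moment_even[OF \<sigma>(1)])
  then have "has_bochner_integral lborel (\<lambda>x. sqrt (pi / \<alpha>) * (normal_density 0 \<sigma> x * (x - 0) ^ (2 * j)))
     (sqrt (pi / \<alpha>) * (fact (2 * j) / ((2 / \<sigma>\<^sup>2) ^ j * fact j)))"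
    by (rule has_bochner_integral_mult_right)
  moreover have "sqrt (pi / \<alpha>) * (normal_density 0 \<sigma> x * (x - 0) ^ (2 * j)) = x ^ (2 * j) * exp (- \<alpha> * x\<^sup>2)" for x
  proof -
    have eq: "2 * pi * \<sigma>\<^sup>2 = pi / \<alpha>"
      using assms by (simp add: \<sigma>(2))
    have "sqrt (pi / \<alpha>) * normal_density 0 \<sigma> x = exp (- x\<^sup>2 / (2 * \<sigma>\<^sup>2))"
      unfolding normal_density_def eq using assms by simp
    also have "- x\<^sup>2 / (2 * \<sigma>\<^sup>2) = - \<alpha> * x\<^sup>2"
      using assms by (simp add: \<sigma>(2))
    finally show ?thesis
      by (metis (no_types, lifting) diff_zero mult.assoc mult.commute)
  qed
  moreover have "2 / \<sigma>\<^sup>2 = 4 * \<alpha>"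
    using assms by (simp add: \<sigma>(2))
  ultimately show ?thesis by (simp only:)
qed

lemma gaussian_quartic_integral:
  fixes \<alpha> :: real and c0 c2 c4 :: complex
  assumes "\<alpha> > 0"
  shows "has_bochner_integral lborel (\<lambda>t. (c0 + c2 * of_real (t\<^sup>2) + c4 * of_real (t ^ 4)) * of_real (exp (- \<alpha> * t\<^sup>2)))
     (of_real (sqrt (pi / \<alpha>)) * (c0 + c2 / of_real (2 * \<alpha>) + 3 * c4 / of_real (4 * \<alpha>\<^sup>2)))"
proof -
  have *: "has_bochner_integral lborel (\<lambda>t. complex_of_real (t ^ (2 * j) * exp (- \<alpha> * t\<^sup>2)))
     (of_real (sqrt (pi / \<alpha>) * (fact (2 * j) / ((4 * \<alpha>) ^ j * fact j))))" for j
    by (rule has_bochner_integral_of_real[OF gaussian_moment[OF assms]])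
  have "has_bochner_integral lborel (\<lambda>t. c0 * complex_of_real (t ^ (2 * 0) * exp (- \<alpha> * t\<^sup>2))
     + c2 * complex_of_real (t ^ (2 * 1) * exp (- \<alpha> * t\<^sup>2)) + c4 * complex_of_real (t ^ (2 * 2) * exp (- \<alpha> * t\<^sup>2)))
     (c0 * of_real (sqrt (pi / \<alpha>) * (fact (2 * 0) / ((4 * \<alpha>) ^ 0 * fact 0)))
      + c2 * of_real (sqrt (pi / \<alpha>) * (fact (2 * 1) / ((4 * \<alpha>) ^ 1 * fact 1)))
      + c4 * of_real (sqrt (pi / \<alpha>) * (fact (2 * 2) / ((4 * \<alpha>) ^ 2 * fact 2))))"
    by (intro has_bochner_integral_add has_bochner_integral_mult_right *)
  then show ?thesis
    by (rule has_bochner_integral_cong[THEN iffD1, rotated -1])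
       (use assms in \<open>auto simp: fact_numeral field_simps power2_eq_square\<close>)
qed

section \<open>The theta coefficients near the cusp\<close>

lemma has_sum_finite_sum:
  assumes "finite M" "\<And>\<mu>. \<mu> \<in> M \<Longrightarrow> (f \<mu> has_sum s \<mu>) A"
  shows "((\<lambda>r. \<Sum>\<mu>\<in>M. f \<mu> r) has_sum (\<Sum>\<mu>\<in>M. s \<mu> :: complex)) A"
  using assms by (induction M rule: finite_induct) (auto intro!: has_sum_add)

definition residue_class :: "nat \<Rightarrow> int \<Rightarrow> int set" where
  "residue_class m \<mu> = {r. r mod (2 * int m) = \<mu> mod (2 * int m)}"

lemma jtheta_eq_theta_moment: "jtheta m \<mu> = theta_moment m (residue_class m \<mu>) 0"
  by (simp add: fun_eq_iff jtheta_def theta_moment_def residue_class_def)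

text \<open>
  Each integer lies in exactly one residue class, so a combination of the \<open>2 m\<close> theta series is a single
  series over all integers with periodic coefficients, which is the form needed for Fourier analysis in \<open>z\<close>.
\<close>

lemma residue_combination_has_sum:
  assumes "m \<ge> 1" "Im \<tau> > 0"
  shows "((\<lambda>r. G (r mod (2 * int m)) * (of_int r ^ j * e ((of_int r)\<^sup>2 / (4 * of_nat m) * \<tau> + of_int r * z)))
    has_sum (\<Sum>\<mu>\<in>{0..<2 * int m}. G \<mu> * theta_moment m (residue_class m \<mu>) j \<tau> z)) UNIV"
proof -
  define X where "X = (\<lambda>r. of_int r ^ j * e ((of_int r)\<^sup>2 / (4 * of_nat m) * \<tau> + of_int r * z))"
  have "((\<lambda>r. \<Sum>\<mu>\<in>{0..<2 * int m}. if r \<in> residue_class m \<mu> then G \<mu> * X r else 0)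
    has_sum (\<Sum>\<mu>\<in>{0..<2 * int m}. G \<mu> * theta_moment m (residue_class m \<mu>) j \<tau> z)) UNIV"
  proof (rule has_sum_finite_sum)
    fix \<mu>
    have "((\<lambda>r. G \<mu> * X r) has_sum G \<mu> * theta_moment m (residue_class m \<mu>) j \<tau> z) (residue_class m \<mu>)"
      unfolding X_def by (intro has_sum_cmult_right theta_moment_has_sum assms)
    then show "((\<lambda>r. if r \<in> residue_class m \<mu> then G \<mu> * X r else 0)
      has_sum G \<mu> * theta_moment m (residue_class m \<mu>) j \<tau> z) UNIV"
      by (rule has_sum_cong_neutral[THEN iffD1, rotated -1]) auto
  qed simp
  also have "(\<lambda>r. \<Sum>\<mu>\<in>{0..<2 * int m}. if r \<in> residue_class m \<mu> then G \<mu> * X r else 0)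
     = (\<lambda>r. G (r mod (2 * int m)) * X r)"
  proof
    fix r
    have "(\<Sum>\<mu>\<in>{0..<2 * int m}. if r \<in> residue_class m \<mu> then G \<mu> * X r else 0)
      = (\<Sum>\<mu>\<in>{0..<2 * int m}. if \<mu> = r mod (2 * int m) then G \<mu> * X r else 0)"
      by (intro sum.cong refl) (auto simp: residue_class_def)
    also have "\<dots> = G (r mod (2 * int m)) * X r"
      using assms by simp
    finally show "(\<Sum>\<mu>\<in>{0..<2 * int m}. if r \<in> residue_class m \<mu> then G \<mu> * X r else 0) = G (r mod (2 * int m)) * X r" .
  qed
  finally show ?thesis unfolding X_def .
qed

lemma theta_expansion_has_sum:
  assumes "theta_expansion m \<phi> g" "m \<ge> 1" "Im \<tau> > 0"
  shows "((\<lambda>r. g (r mod (2 * int m)) \<tau> * e ((of_int r)\<^sup>2 / (4 * of_nat m) * \<tau> + of_int r * z))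
    has_sum \<phi> \<tau> z) UNIV"
  using residue_combination_has_sum[OF assms(2,3), of "\<lambda>\<mu>. g \<mu> \<tau>" 0 z] assms
  by (simp add: theta_expansion_def jtheta_eq_theta_moment)

text \<open>
  Both the theta expansion and the expansion at the cusp are Fourier series of \<open>x \<mapsto> \<phi> \<tau> x\<close>; compare their
  coefficients at the frequency \<open>\<mu>\<close>.
\<close>

lemma theta_coefficient_series:
  assumes \<phi>: "theta_expansion m \<phi> g" "m \<ge> 1" "Im \<tau> > 0" and \<mu>: "\<mu> \<in> {0..<2 * int m}"
    and C: "\<And>z. ((\<lambda>(n, r). C n r * e (of_int n * \<tau> + of_int r * z)) has_sum \<phi> \<tau> z) S"
  shows "((\<lambda>(n, r). if r = \<mu> then C n r * e (of_int n * \<tau>) else 0)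
    has_sum g \<mu> \<tau> * e ((of_int \<mu>)\<^sup>2 / (4 * of_nat m) * \<tau>)) S"
proof -
  define a where "a = (\<lambda>r. g (r mod (2 * int m)) \<tau> * e ((of_int r)\<^sup>2 / (4 * of_nat m) * \<tau>))"
  have a: "((\<lambda>r. a r * e (of_int r * of_real x)) has_sum \<phi> \<tau> (of_real x)) UNIV" for x
    using theta_expansion_has_sum[OF \<phi>, of "of_real x"] by (simp add: a_def e_add mult.assoc)
  have c: "((\<lambda>i. (case i of (n, r) \<Rightarrow> C n r * e (of_int n * \<tau>)) * e (of_int (snd i) * of_real x)) has_sum \<phi> \<tau> (of_real x)) S" for x
    using C[of "of_real x"] by (simp add: case_prod_beta' e_add mult.assoc)
  have "((\<lambda>r. if r = \<mu> then a r else 0) has_sum a \<mu>) UNIV"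
    by (rule has_sum_finite_neutralI[of "{\<mu>}"]) auto
  moreover have "((\<lambda>r. if r = \<mu> then a r else 0) has_sum
     integral {0..1} (\<lambda>x. \<phi> \<tau> (of_real x) * e (- (of_int \<mu> * of_real x)))) UNIV"
    by (rule fourier_coefficient[OF a])
  ultimately have "integral {0..1} (\<lambda>x. \<phi> \<tau> (of_real x) * e (- (of_int \<mu> * of_real x))) = a \<mu>"
    using has_sum_unique by blast
  moreover have "a \<mu> = g \<mu> \<tau> * e ((of_int \<mu>)\<^sup>2 / (4 * of_nat m) * \<tau>)"
    using \<mu> by (simp add: a_def)
  moreover have "(\<lambda>i. if snd i = \<mu> then (case i of (n, r) \<Rightarrow> C n r * e (of_int n * \<tau>)) else 0)
     = (\<lambda>(n, r). if r = \<mu> then C n r * e (of_int n * \<tau>) else 0)"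
    by (auto simp: fun_eq_iff)
  ultimately show ?thesis
    using fourier_coefficient[OF c, of \<mu>] by simp
qed

lemma e_of_nat_mult: "e (of_nat n * w) = e w ^ n"
  by (simp add: e_def exp_of_nat_mult[symmetric] mult_ac)

text \<open>
  In the series for \<open>g \<mu> \<tau> \<cdot> e (\<mu>\<^sup>2 \<tau> / (4 m))\<close> only \<open>n \<ge> \<mu>\<^sup>2 / (4 m)\<close> occur.  Let \<open>n0\<close> be the least such
  integer: taking out \<open>e (n0 \<tau>)\<close> leaves a power series in \<open>e \<tau>\<close>, and \<open>\<delta> = n0 - \<mu>\<^sup>2 / (4 m)\<close>.
\<close>

lemma theta_coefficient_power_series:
  assumes \<phi>: "theta_expansion m \<phi> g" "m \<ge> 1" and \<mu>: "\<mu> \<in> {0..<2 * int m}"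
    and C: "\<And>\<tau> z. Im \<tau> > 0 \<Longrightarrow> ((\<lambda>(n, r). C n r * e (of_int n * \<tau> + of_int r * z)) has_sum \<phi> \<tau> z)
          {(n, r). 0 \<le> n \<and> r\<^sup>2 \<le> 4 * n * int m}"
  shows "\<exists>\<delta>\<ge>0. \<exists>Q. Q holomorphic_on ball 0 1 \<and> (\<forall>\<tau>. Im \<tau> > 0 \<longrightarrow> g \<mu> \<tau> = e (of_real \<delta> * \<tau>) * Q (e \<tau>))"
proof -
  define n0 where "n0 = \<lceil>real_of_int (\<mu>\<^sup>2) / (4 * real m)\<rceil>"
  define \<delta> where "\<delta> = real_of_int n0 - real_of_int (\<mu>\<^sup>2) / (4 * real m)"
  define q where "q = (\<lambda>j::nat. C (n0 + int j) \<mu>)"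
  define Q where "Q = (\<lambda>x. \<Sum>j. q j * x ^ j)"
  have n0: "n0 \<ge> 0"
  proof -
    have "real_of_int (\<mu>\<^sup>2) / (4 * real m) \<ge> 0" by simp
    then show ?thesis
      unfolding n0_def le_ceiling_iff by (rule less_le_trans[rotated]) simp
  qed
  have n0_iff: "n0 \<le> n \<longleftrightarrow> \<mu>\<^sup>2 \<le> 4 * n * int m" for n
  proof -
    have "n0 \<le> n \<longleftrightarrow> real_of_int (\<mu>\<^sup>2) / (4 * real m) \<le> real_of_int n"
      unfolding n0_def by (rule ceiling_le_iff)
    also have "\<dots> \<longleftrightarrow> real_of_int (\<mu>\<^sup>2) \<le> real_of_int (4 * n * int m)"
      using \<phi>(2) by (simp add: pos_divide_le_eq mult_ac)
    also have "\<dots> \<longleftrightarrow> \<mu>\<^sup>2 \<le> 4 * n * int m"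
      by (rule of_int_le_iff)
    finally show ?thesis .
  qed
  have \<delta>: "\<delta> \<ge> 0"
    unfolding \<delta>_def n0_def using le_of_int_ceiling[of "real_of_int (\<mu>\<^sup>2) / (4 * real m)"] by simp
  have sums: "(\<lambda>j. q j * e \<tau> ^ j) sums (g \<mu> \<tau> * e (- (of_real \<delta> * \<tau>)))" if \<tau>: "Im \<tau> > 0" for \<tau>
  proof -
    let ?S = "{(n, r). 0 \<le> n \<and> r\<^sup>2 \<le> 4 * n * int m}"
    let ?f = "\<lambda>(n, r). if r = \<mu> then C n r * e (of_int n * \<tau>) else 0"
    let ?i = "\<lambda>j::nat. (n0 + int j, \<mu>)"
    have img: "range ?i = {(n, r). r = \<mu> \<and> n0 \<le> n}"
    proof safe
      fix n assume "n0 \<le> n"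
      then have "(n, \<mu>) = ?i (nat (n - n0))" by simp
      then show "(n, \<mu>) \<in> range ?i" by blast
    qed auto
    have sub: "x \<in> ?S" if "x \<in> range ?i" for x
      using that n0 n0_iff[of "fst x"] unfolding img by auto
    have zero: "?f x = 0" if "x \<in> ?S" "x \<notin> range ?i" for x
      using that n0_iff[of "fst x"] unfolding img by (auto split: if_splits)
    have "(?f has_sum g \<mu> \<tau> * e ((of_int \<mu>)\<^sup>2 / (4 * of_nat m) * \<tau>)) ?S"
      by (rule theta_coefficient_series[OF \<phi> \<tau> \<mu> C[OF \<tau>]])
    then have "(?f has_sum g \<mu> \<tau> * e ((of_int \<mu>)\<^sup>2 / (4 * of_nat m) * \<tau>)) (range ?i)"
      by (subst has_sum_cong_neutral[of ?S "range ?i" ?f ?f]) (use sub zero in blast)+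
    then have "((\<lambda>j. q j * e (of_int (n0 + int j) * \<tau>)) has_sum g \<mu> \<tau> * e ((of_int \<mu>)\<^sup>2 / (4 * of_nat m) * \<tau>)) UNIV"
      by (subst (asm) has_sum_reindex) (auto simp: inj_on_def o_def q_def)
    then have "((\<lambda>j. q j * e (of_int (n0 + int j) * \<tau>) * e (- (of_int n0 * \<tau>))) has_sum
        g \<mu> \<tau> * e ((of_int \<mu>)\<^sup>2 / (4 * of_nat m) * \<tau>) * e (- (of_int n0 * \<tau>))) UNIV"
      by (rule has_sum_cmult_left)
    moreover have "e (of_int (n0 + int j) * \<tau>) * e (- (of_int n0 * \<tau>)) = e \<tau> ^ j" for j
      by (simp add: algebra_simps flip: e_add e_of_nat_mult)
    moreover have "e ((of_int \<mu>)\<^sup>2 / (4 * of_nat m) * \<tau>) * e (- (of_int n0 * \<tau>)) = e (- (of_real \<delta> * \<tau>))"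
      by (simp add: \<delta>_def algebra_simps flip: e_add)
    ultimately show ?thesis
      by (intro has_sum_imp_sums) (simp add: mult.assoc)
  qed
  have "Q holomorphic_on ball 0 1"
  proof (rule power_series_holomorphic)
    fix w :: complex assume "w \<in> ball 0 1"
    then have w: "norm w < 1" by simp
    \<comment> \<open>The series converges at every point \<open>e \<tau>\<close>, in particular at a real \<open>\<rho>\<close> between \<open>|w|\<close> and 1.\<close>
    define \<rho> where "\<rho> = (1 + norm w) / 2"
    have \<rho>: "0 < \<rho>" "\<rho> < 1" "norm w < \<rho>" using w by (auto simp: \<rho>_def add_pos_nonneg)
    define \<tau> where "\<tau> = \<i> * of_real (- ln \<rho> / (2 * pi))"
    have "Im \<tau> > 0" using \<rho> by (simp add: \<tau>_def divide_neg_pos)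
    moreover have "e \<tau> = of_real \<rho>"
    proof -
      have "2 * of_real pi * \<i> * \<tau> = of_real (ln \<rho>)"
        by (simp add: \<tau>_def complex_eq_iff)
      then show ?thesis
        using \<rho> by (simp add: e_def exp_of_real)
    qed
    ultimately have "summable (\<lambda>j. q j * of_real \<rho> ^ j)"
      using sums[of \<tau>] by (auto simp: sums_iff)
    then have "summable (\<lambda>j. q j * w ^ j)"
      by (rule powser_inside) (use \<rho> in auto)
    then show "(\<lambda>j. q j * (w - 0) ^ j) sums Q w"
      by (simp add: Q_def summable_sums)
  qed
  moreover have "g \<mu> \<tau> = e (of_real \<delta> * \<tau>) * Q (e \<tau>)" if "Im \<tau> > 0" for \<tau>
  proof -
    have "Q (e \<tau>) = g \<mu> \<tau> * e (- (of_real \<delta> * \<tau>))"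
      unfolding Q_def using sums[OF that] by (simp add: sums_iff)
    moreover have "e (of_real \<delta> * \<tau>) * e (- (of_real \<delta> * \<tau>)) = 1"
      unfolding e_add[symmetric] by (simp add: e_def)
    ultimately show ?thesis by (simp add: algebra_simps)
  qed
  ultimately show ?thesis using \<delta> by blast
qed

text \<open>
  If \<open>\<delta> > 0\<close> the factor \<open>e (\<delta> \<tau>)\<close> decays.  If \<open>\<delta> = 0\<close> the function itself need not decay, but its derivative
  loses the constant term of \<open>Q\<close> and gains the factor \<open>e \<tau>\<close>.
\<close>

lemma exp_power_series_decay:
  fixes G Q :: "complex \<Rightarrow> complex"
  assumes \<delta>: "\<delta> \<ge> 0" and Q: "Q holomorphic_on ball 0 1"
    and G: "\<And>\<tau>. Im \<tau> > 0 \<Longrightarrow> G \<tau> = e (of_real \<delta> * \<tau>) * Q (e \<tau>)"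
  shows "(\<forall>\<tau>. Im \<tau> > 0 \<longrightarrow> (G has_field_derivative deriv G \<tau>) (at \<tau>)) \<and>
    (\<exists>K c. c > 0 \<and> (\<forall>\<tau>. Im \<tau> \<ge> 1/2 \<longrightarrow> norm (G \<tau>) \<le> K \<and> norm (deriv G \<tau>) \<le> K * exp (- c * Im \<tau>)))"
proof -
  define D where "D = (\<lambda>\<tau>. 2 * of_real pi * \<i> * e (of_real \<delta> * \<tau>) * (of_real \<delta> * Q (e \<tau>) + e \<tau> * deriv Q (e \<tau>)))"
  have in_ball: "e \<tau> \<in> ball 0 1" if "Im \<tau> > 0" for \<tau>
    using that by (simp add: norm_e)
  have D: "(G has_field_derivative D \<tau>) (at \<tau>)" if \<tau>: "Im \<tau> > 0" for \<tau>
  proof -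
    have e': "(e has_field_derivative 2 * of_real pi * \<i> * e \<tau>) (at \<tau>)"
      by (rule DERIV_cong[OF has_field_derivative_e[OF DERIV_ident]]) simp
    have Q': "(Q has_field_derivative deriv Q (e \<tau>)) (at (e \<tau>))"
      using holomorphic_derivI[OF Q open_ball in_ball[OF \<tau>]] .
    have l: "((\<lambda>t. of_real \<delta> * t) has_field_derivative of_real \<delta>) (at \<tau>)"
      by (rule DERIV_cong[OF DERIV_cmult[OF DERIV_ident]]) simp
    have "((\<lambda>t. e (of_real \<delta> * t) * Q (e t)) has_field_derivative D \<tau>) (at \<tau>)"
      by (rule DERIV_cong[OF DERIV_mult[OF has_field_derivative_e[OF l] DERIV_chain2[OF Q' e']]])
         (simp add: D_def algebra_simps)
    then show ?thesis
      by (rule has_field_derivative_transform_within_open[OF _ open_upper_half]) (use \<tau> G in auto)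
  qed
  then have dG: "deriv G \<tau> = D \<tau>" if "Im \<tau> > 0" for \<tau>
    using that DERIV_imp_deriv by blast
  \<comment> \<open>For \<open>Im \<tau> \<ge> 1/2\<close> the point \<open>e \<tau>\<close> stays in the compact disc of radius \<open>\<rho> < 1\<close>.\<close>
  define \<rho> where "\<rho> = exp (- pi)"
  have \<rho>: "\<rho> < 1" by (simp add: \<rho>_def)
  have sub: "cball (0::complex) \<rho> \<subseteq> ball 0 1" using \<rho> by auto
  have "bounded (Q ` cball 0 \<rho>)"
    by (intro compact_imp_bounded compact_continuous_image compact_cball
        holomorphic_on_imp_continuous_on[OF holomorphic_on_subset[OF Q sub]])
  then obtain K1 where K1: "\<And>x. x \<in> cball 0 \<rho> \<Longrightarrow> norm (Q x) \<le> K1"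
    unfolding bounded_iff by blast
  have "bounded (deriv Q ` cball 0 \<rho>)"
    by (intro compact_imp_bounded compact_continuous_image compact_cball
        holomorphic_on_imp_continuous_on[OF holomorphic_on_subset[OF holomorphic_deriv[OF Q open_ball] sub]])
  then obtain K2 where K2: "\<And>x. x \<in> cball 0 \<rho> \<Longrightarrow> norm (deriv Q x) \<le> K2"
    unfolding bounded_iff by blast
  have "0 \<in> cball (0::complex) \<rho>" by (simp add: \<rho>_def)
  then have K0: "K1 \<ge> 0" "K2 \<ge> 0"
    using K1[of 0] K2[of 0] norm_ge_zero order_trans by blast+
  define c where "c = 2 * pi * (if \<delta> = 0 then 1 else \<delta>)"
  define K where "K = K1 + 2 * pi * (\<delta> * K1 + K2)"
  have c: "c > 0" using \<delta> by (auto simp: c_def)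
  have "norm (G \<tau>) \<le> K \<and> norm (deriv G \<tau>) \<le> K * exp (- c * Im \<tau>)" if \<tau>: "Im \<tau> \<ge> 1/2" for \<tau>
  proof
    have pos: "Im \<tau> > 0" using \<tau> by simp
    have "e \<tau> \<in> cball 0 \<rho>" using \<tau> by (simp add: norm_e \<rho>_def)
    note Kb = K1[OF this] K2[OF this]
    have ne: "norm (e (of_real \<delta> * \<tau>)) = exp (- 2 * pi * \<delta> * Im \<tau>)" by (simp add: norm_e)
    have ne1: "norm (e (of_real \<delta> * \<tau>)) \<le> 1" unfolding ne using \<delta> pos by simp
    have "norm (G \<tau>) \<le> 1 * K1"
      unfolding G[OF pos] norm_mult by (intro mult_mono ne1 Kb) auto
    also have "\<dots> \<le> K" unfolding K_def using K0 \<delta> by simp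
    finally show "norm (G \<tau>) \<le> K" .
    have "norm (of_real \<delta> * Q (e \<tau>) + e \<tau> * deriv Q (e \<tau>)) \<le> \<delta> * K1 + exp (- 2 * pi * Im \<tau>) * K2"
      using \<delta> Kb by (intro norm_triangle_mono) (auto simp: norm_mult norm_e intro: mult_left_mono)
    moreover have "norm (deriv G \<tau>) = 2 * pi * exp (- 2 * pi * \<delta> * Im \<tau>) * norm (of_real \<delta> * Q (e \<tau>) + e \<tau> * deriv Q (e \<tau>))"
      unfolding dG[OF pos] D_def norm_mult ne by simp
    ultimately have 1: "norm (deriv G \<tau>) \<le> 2 * pi * exp (- 2 * pi * \<delta> * Im \<tau>) * (\<delta> * K1 + exp (- 2 * pi * Im \<tau>) * K2)"
      by (simp add: mult_left_mono)
    show "norm (deriv G \<tau>) \<le> K * exp (- c * Im \<tau>)"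
    proof (cases "\<delta> = 0")
      case True
      then have "norm (deriv G \<tau>) \<le> 2 * pi * K2 * exp (- c * Im \<tau>)"
        using 1 by (simp add: c_def mult_ac)
      also have "\<dots> \<le> K * exp (- c * Im \<tau>)"
        unfolding K_def using K0 True by (intro mult_right_mono) auto
      finally show ?thesis .
    next
      case False
      have "\<delta> * K1 + exp (- 2 * pi * Im \<tau>) * K2 \<le> \<delta> * K1 + 1 * K2"
        using K0 pos by (intro add_left_mono mult_right_mono) auto
      then have le: "2 * pi * exp (- 2 * pi * \<delta> * Im \<tau>) * (\<delta> * K1 + exp (- 2 * pi * Im \<tau>) * K2)
         \<le> 2 * pi * exp (- 2 * pi * \<delta> * Im \<tau>) * (\<delta> * K1 + 1 * K2)"
        by (intro mult_left_mono) auto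
      have "norm (deriv G \<tau>) \<le> 2 * pi * exp (- 2 * pi * \<delta> * Im \<tau>) * (\<delta> * K1 + 1 * K2)"
        using 1 le by (rule order_trans)
      also have "\<dots> = 2 * pi * (\<delta> * K1 + K2) * exp (- c * Im \<tau>)"
        using False by (simp add: c_def mult_ac)
      also have "\<dots> \<le> K * exp (- c * Im \<tau>)"
        unfolding K_def using K0 \<delta> by (intro mult_right_mono) auto
      finally show ?thesis .
    qed
  qed
  then show ?thesis using D dG c by auto
qed

lemma jacobi_form_theta_coefficient:
  assumes "jacobi_form k m \<phi>" "theta_expansion m \<phi> g" "m \<ge> 1" "\<mu> \<in> {0..<2 * int m}"
  shows "Im \<tau> > 0 \<Longrightarrow> (g \<mu> has_field_derivative deriv (g \<mu>) \<tau>) (at \<tau>)"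
    and "\<exists>K c. c > 0 \<and> (\<forall>\<tau>. Im \<tau> \<ge> 1/2 \<longrightarrow> norm (g \<mu> \<tau>) \<le> K \<and> norm (deriv (g \<mu>) \<tau>) \<le> K * exp (- c * Im \<tau>))"
proof -
  obtain C where C: "\<And>\<tau> z. Im \<tau> > 0 \<Longrightarrow>
      ((\<lambda>(n, r). C n r * e (of_int n * \<tau> + of_int r * z)) has_sum \<phi> \<tau> z) {(n, r). 0 \<le> n \<and> r\<^sup>2 \<le> 4 * n * int m}"
    using assms(1) unfolding jacobi_form_def by blast
  obtain \<delta> Q where "\<delta> \<ge> 0" "Q holomorphic_on ball 0 1"
    "\<And>\<tau>. Im \<tau> > 0 \<Longrightarrow> g \<mu> \<tau> = e (of_real \<delta> * \<tau>) * Q (e \<tau>)"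
    using theta_coefficient_power_series[OF assms(2-4) C] by blast
  note * = exp_power_series_decay[OF this]
  show "Im \<tau> > 0 \<Longrightarrow> (g \<mu> has_field_derivative deriv (g \<mu>) \<tau>) (at \<tau>)"
    using * by blast
  show "\<exists>K c. c > 0 \<and> (\<forall>\<tau>. Im \<tau> \<ge> 1/2 \<longrightarrow> norm (g \<mu> \<tau>) \<le> K \<and> norm (deriv (g \<mu>) \<tau>) \<le> K * exp (- c * Im \<tau>))"
    using * by blast
qed

section \<open>The integral over one fibre\<close>

text \<open>
  The derivatives of \<open>\<Sum>\<mu>. g \<mu> \<tau> \<cdot> jtheta m \<mu> \<tau> z\<close> with respect to \<open>\<tau>\<close> and \<open>z\<close>, where \<open>g'\<close> stands for the
  derivatives of the coefficients.
\<close>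

definition theta_dtau ::
  "nat \<Rightarrow> (int \<Rightarrow> complex \<Rightarrow> complex) \<Rightarrow> (int \<Rightarrow> complex \<Rightarrow> complex) \<Rightarrow> complex \<Rightarrow> complex \<Rightarrow> complex" where
  "theta_dtau m g g' \<tau> z = (\<Sum>\<mu>\<in>{0..<2 * int m}. g' \<mu> \<tau> * theta_moment m (residue_class m \<mu>) 0 \<tau> z
     + g \<mu> \<tau> * (2 * of_real pi * \<i> / (4 * of_nat m) * theta_moment m (residue_class m \<mu>) 2 \<tau> z))"

definition theta_dz :: "nat \<Rightarrow> (int \<Rightarrow> complex \<Rightarrow> complex) \<Rightarrow> complex \<Rightarrow> complex \<Rightarrow> complex" where
  "theta_dz m g \<tau> z = (\<Sum>\<mu>\<in>{0..<2 * int m}. g \<mu> \<tau> * (2 * of_real pi * \<i> * theta_moment m (residue_class m \<mu>) 1 \<tau> z))"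

lemma theta_expansion_derivatives:
  assumes \<phi>: "theta_expansion m \<phi> g" and m: "m \<ge> 1"
    and g: "\<And>\<mu> t. \<mu> \<in> {0..<2 * int m} \<Longrightarrow> Im t > 0 \<Longrightarrow> (g \<mu> has_field_derivative g' \<mu> t) (at t)"
    and \<tau>: "Im \<tau> > 0"
  shows "((\<lambda>t. \<phi> t z) has_field_derivative theta_dtau m g g' \<tau> z) (at \<tau>)"
    and "(\<phi> \<tau> has_field_derivative theta_dz m g \<tau> z) (at z)"
    and "(\<lambda>t. theta_dz m g t z) field_differentiable (at \<tau>)"
    and "theta_dz m g \<tau> field_differentiable (at z)"
    and "theta_dtau m g g' \<tau> field_differentiable (at z)"
proof -
  let ?\<Theta> = "\<lambda>\<mu>. theta_moment m (residue_class m \<mu>)"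
  have \<phi>_eq: "\<phi> t z = (\<Sum>\<mu>\<in>{0..<2 * int m}. g \<mu> t * ?\<Theta> \<mu> 0 t z)" if "Im t > 0" for t z
    using \<phi> that by (simp add: theta_expansion_def jtheta_eq_theta_moment)
  have "((\<lambda>t. \<Sum>\<mu>\<in>{0..<2 * int m}. g \<mu> t * ?\<Theta> \<mu> 0 t z) has_field_derivative theta_dtau m g g' \<tau> z) (at \<tau>)"
    unfolding theta_dtau_def
    by (intro DERIV_sum DERIV_cong[OF DERIV_mult[OF g theta_moment_deriv_tau[OF m \<tau>]]] \<tau>)
       (auto simp: mult_ac numeral_2_eq_2)
  then show "((\<lambda>t. \<phi> t z) has_field_derivative theta_dtau m g g' \<tau> z) (at \<tau>)"
    by (rule has_field_derivative_transform_within_open[OF _ open_upper_half]) (use \<tau> \<phi>_eq in auto)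
  have "((\<lambda>z. \<Sum>\<mu>\<in>{0..<2 * int m}. g \<mu> \<tau> * ?\<Theta> \<mu> 0 \<tau> z) has_field_derivative theta_dz m g \<tau> z) (at z)"
    unfolding theta_dz_def
    by (intro DERIV_sum DERIV_cong[OF DERIV_cmult[OF theta_moment_deriv_z[OF m \<tau>]]]) simp
  moreover have "\<phi> \<tau> = (\<lambda>z. \<Sum>\<mu>\<in>{0..<2 * int m}. g \<mu> \<tau> * ?\<Theta> \<mu> 0 \<tau> z)"
    using \<phi>_eq[OF \<tau>] by auto
  ultimately show "(\<phi> \<tau> has_field_derivative theta_dz m g \<tau> z) (at z)" by simp
  have ft: "(\<lambda>t. ?\<Theta> \<mu> j t z) field_differentiable (at \<tau>)" for \<mu> j
    using theta_moment_deriv_tau[OF m \<tau>] field_differentiable_def by blast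
  have fz: "(\<lambda>z. ?\<Theta> \<mu> j \<tau> z) field_differentiable (at z)" for \<mu> j
    using theta_moment_deriv_z[OF m \<tau>] field_differentiable_def by blast
  have fg: "g \<mu> field_differentiable (at \<tau>)" if "\<mu> \<in> {0..<2 * int m}" for \<mu>
    using g[OF that \<tau>] field_differentiable_def by blast
  show "(\<lambda>t. theta_dz m g t z) field_differentiable (at \<tau>)"
    unfolding theta_dz_def
    by (intro field_differentiable_sum field_differentiable_mult field_differentiable_const ft fg)
  show "theta_dz m g \<tau> field_differentiable (at z)" "theta_dtau m g g' \<tau> field_differentiable (at z)"
    unfolding theta_dz_def theta_dtau_def
    by (intro field_differentiable_sum field_differentiable_add field_differentiable_mult field_differentiable_const fz)+
qed

text \<open>
  The function on the right is the expression \<open>P\<close> of \<open>DJ_formula\<close> for \<open>c = 4 \<pi> m\<close>.  On the \<open>r\<close>-th term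
  its three contributions combine through \<open>r\<^sup>2 / (4 m) + r p + m p\<^sup>2 = m (r / (2 m) + p)\<^sup>2\<close>, so the coefficient
  depends on \<open>r\<close> and \<open>p\<close> only through \<open>r / (2 m) + p\<close> and the residue of \<open>r\<close>.
\<close>

lemma completed_square_has_sum:
  assumes \<phi>: "theta_expansion m \<phi> g" and m: "m \<ge> 1" and \<tau>: "Im \<tau> > 0"
  defines "s \<equiv> (\<lambda>r p. 2 * of_real pi * \<i> * of_nat m * of_real ((real_of_int r / (2 * real m) + p)\<^sup>2))"
  shows "((\<lambda>r. (g' (r mod (2 * int m)) \<tau> + s r p * g (r mod (2 * int m)) \<tau>)
       * e ((of_int r)\<^sup>2 / (4 * of_nat m) * \<tau> + of_int r * z))
    has_sum (theta_dtau m g g' \<tau> z + of_real p * theta_dz m g \<tau> z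
       + \<i> / 2 * of_real (4 * pi * real m * p\<^sup>2) * \<phi> \<tau> z)) UNIV"
proof -
  define E where "E = (\<lambda>r. e ((of_int r)\<^sup>2 / (4 * of_nat m) * \<tau> + of_int r * z))"
  let ?M = "2 * int m"
  have E: "e ((of_int r)\<^sup>2 / (4 * of_nat m) * \<tau> + of_int r * z) = E r" for r
    by (simp add: E_def)
  note R = residue_combination_has_sum[OF m \<tau>, where z = z, unfolded E]
  let ?G2 = "\<lambda>\<mu>. g \<mu> \<tau> * (2 * of_real pi * \<i> / (4 * of_nat m))"
  let ?G1 = "\<lambda>\<mu>. of_real p * (g \<mu> \<tau> * (2 * of_real pi * \<i>))"
  let ?c = "\<i> / 2 * of_real (4 * pi * real m * p\<^sup>2)"
  have 0: "((\<lambda>r. ?c * (g (r mod ?M) \<tau> * E r)) has_sum ?c * \<phi> \<tau> z) UNIV"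
    using theta_expansion_has_sum[OF \<phi> m \<tau>, of z, unfolded E] by (rule has_sum_cmult_right)
  have 1: "((\<lambda>r. ?G1 (r mod ?M) * (of_int r ^ 1 * E r)) has_sum of_real p * theta_dz m g \<tau> z) UNIV"
    using R[of ?G1 1] by (simp add: theta_dz_def sum_distrib_left mult_ac)
  have 2: "((\<lambda>r. g' (r mod ?M) \<tau> * (of_int r ^ 0 * E r) + ?G2 (r mod ?M) * (of_int r ^ 2 * E r))
      has_sum theta_dtau m g g' \<tau> z) UNIV"
    using has_sum_add[OF R[of "\<lambda>\<mu>. g' \<mu> \<tau>" 0] R[of ?G2 2]]
    by (simp add: theta_dtau_def sum.distrib mult.assoc)
  have "g' (r mod ?M) \<tau> * (of_int r ^ 0 * E r) + ?G2 (r mod ?M) * (of_int r ^ 2 * E r)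
     + ?G1 (r mod ?M) * (of_int r ^ 1 * E r) + ?c * (g (r mod ?M) \<tau> * E r)
     = (g' (r mod ?M) \<tau> + s r p * g (r mod ?M) \<tau>) * E r" for r
    using m by (simp add: s_def field_simps power2_eq_square)
  with has_sum_add[OF has_sum_add[OF 2 1] 0] show ?thesis
    unfolding E_def by simp
qed

text \<open>
  For \<open>r = \<mu> + 2 m l\<close> one has \<open>r / (2 m) + y / v = \<mu> / (2 m) + l + y / v\<close>.  So for each residue \<open>\<mu>\<close> the sum
  over \<open>l\<close> and the integral over \<open>0 \<le> y \<le> v\<close> combine to \<open>v\<close> times an integral over the whole line, which is
  evaluated by Gaussian moments.
\<close>

lemma theta_unfolding:
  fixes c0 c2 c4 :: "int \<Rightarrow> complex" and m :: nat and v :: real and J :: "real \<Rightarrow> complex"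
  defines "\<alpha> \<equiv> 4 * pi * real m * v"
  defines "q \<equiv> (\<lambda>\<mu> t. (c0 \<mu> + c2 \<mu> * of_real (t\<^sup>2) + c4 \<mu> * of_real (t ^ 4)) * of_real (exp (- \<alpha> * t\<^sup>2)))"
  assumes m: "m \<ge> 1" and v: "v > 0"
    and sum: "\<And>y. y \<in> {0..v} \<Longrightarrow> ((\<lambda>r. q (r mod (2 * int m)) (of_int r / (2 * real m) + y / v)) has_sum J y) UNIV"
  shows "continuous_on {0..v} J"
    and "integral {0..v} J = of_real (v * sqrt (pi / \<alpha>)) *
      (\<Sum>\<mu>\<in>{0..<2 * int m}. c0 \<mu> + c2 \<mu> / of_real (2 * \<alpha>) + 3 * c4 \<mu> / of_real (4 * \<alpha>\<^sup>2))"
proof -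
  let ?M = "2 * int m"
  define t where "t = (\<lambda>(r::int) y. real_of_int r / (2 * real m) + y / v)"
  define K where "K = (\<Sum>\<mu>\<in>{0..<?M}. norm (c0 \<mu>) + norm (c2 \<mu>) + norm (c4 \<mu>))"
  have M: "?M > 0" using m by simp
  have \<alpha>: "\<alpha> > 0" using m v by (simp add: \<alpha>_def)
  have q_cont: "continuous_on S (q \<mu>)" for S \<mu>
    unfolding q_def by (intro continuous_intros)
  have bound: "norm (q (r mod ?M) (t r y)) \<le> K * ((1 + \<bar>real_of_int r\<bar>) ^ 4
      * exp (- (pi * v / real m) * (real_of_int r)\<^sup>2 + 4 * pi * v * \<bar>real_of_int r\<bar>))"
    if y: "y \<in> {0..v}" for r y
  proof -
    define R where "R = real_of_int r"
    define u where "u = R / (2 * real m)"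
    define p where "p = y / v"
    have p: "0 \<le> p" "p \<le> 1" using y v by (auto simp: p_def)
    have t: "t r y = u + p" by (simp add: t_def u_def R_def p_def)
    have u_le: "\<bar>u\<bar> \<le> \<bar>R\<bar>"
    proof -
      have "\<bar>u\<bar> = \<bar>R\<bar> / (2 * real m)" by (simp add: u_def)
      also have "\<dots> \<le> \<bar>R\<bar> / 1" using m by (intro divide_left_mono) auto
      finally show ?thesis by simp
    qed
    then have t_le: "\<bar>t r y\<bar> \<le> 1 + \<bar>R\<bar>" unfolding t using p by linarith
    have "\<bar>u * p\<bar> \<le> \<bar>u\<bar> * 1"
      unfolding abs_mult using p by (intro mult_left_mono) auto
    \<comment> \<open>A bound uniform in \<open>y\<close> that still decays like a Gaussian in \<open>r\<close>.\<close>
    then have "(t r y)\<^sup>2 \<ge> u\<^sup>2 - 2 * \<bar>u\<bar>"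
      unfolding t by (simp add: power2_eq_square algebra_simps)
    then have "\<alpha> * (t r y)\<^sup>2 \<ge> \<alpha> * (u\<^sup>2 - 2 * \<bar>u\<bar>)"
      using \<alpha> by (intro mult_left_mono) auto
    moreover have "\<alpha> * (u\<^sup>2 - 2 * \<bar>u\<bar>) = (pi * v / real m) * R\<^sup>2 - 4 * pi * v * \<bar>R\<bar>"
      using m by (simp add: \<alpha>_def u_def power_divide field_simps power2_eq_square)
    ultimately have "exp (- \<alpha> * (t r y)\<^sup>2) \<le> exp (- (pi * v / real m) * R\<^sup>2 + 4 * pi * v * \<bar>R\<bar>)"
      by simp
    moreover have "norm (c0 (r mod ?M) + c2 (r mod ?M) * of_real ((t r y)\<^sup>2) + c4 (r mod ?M) * of_real (t r y ^ 4))
        \<le> K * (1 + \<bar>R\<bar>) ^ 4"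
    proof -
      have pow: "\<bar>t r y\<bar> ^ n \<le> (1 + \<bar>R\<bar>) ^ 4" if "n \<le> 4" for n
      proof -
        have "\<bar>t r y\<bar> ^ n \<le> (1 + \<bar>R\<bar>) ^ n" using t_le by (intro power_mono) auto
        also have "\<dots> \<le> (1 + \<bar>R\<bar>) ^ 4" using that by (intro power_increasing) auto
        finally show ?thesis .
      qed
      have "norm (c0 (r mod ?M) + c2 (r mod ?M) * of_real ((t r y)\<^sup>2) + c4 (r mod ?M) * of_real (t r y ^ 4))
        \<le> norm (c0 (r mod ?M)) * \<bar>t r y\<bar> ^ 0 + norm (c2 (r mod ?M)) * \<bar>t r y\<bar> ^ 2 + norm (c4 (r mod ?M)) * \<bar>t r y\<bar> ^ 4"
        by (intro order_trans[OF norm_triangle_ineq] add_mono) (auto simp: norm_mult norm_power)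
      also have "\<dots> \<le> norm (c0 (r mod ?M)) * (1 + \<bar>R\<bar>) ^ 4 + norm (c2 (r mod ?M)) * (1 + \<bar>R\<bar>) ^ 4
         + norm (c4 (r mod ?M)) * (1 + \<bar>R\<bar>) ^ 4"
        by (intro add_mono mult_left_mono pow) auto
      also have "\<dots> = (norm (c0 (r mod ?M)) + norm (c2 (r mod ?M)) + norm (c4 (r mod ?M))) * (1 + \<bar>R\<bar>) ^ 4"
        by (simp add: algebra_simps)
      also have "norm (c0 (r mod ?M)) + norm (c2 (r mod ?M)) + norm (c4 (r mod ?M)) \<le> K"
        unfolding K_def by (rule member_le_sum) (use M in auto)
      finally show ?thesis by (simp add: mult_right_mono)
    qed
    ultimately have "norm (q (r mod ?M) (t r y)) \<le> (K * (1 + \<bar>R\<bar>) ^ 4) * exp (- (pi * v / real m) * R\<^sup>2 + 4 * pi * v * \<bar>R\<bar>)"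
      unfolding q_def norm_mult by (intro mult_mono) (auto simp: K_def intro!: mult_nonneg_nonneg sum_nonneg)
    then show ?thesis by (simp add: R_def mult.assoc)
  qed
  have summ: "(\<lambda>r. K * ((1 + \<bar>real_of_int r\<bar>) ^ 4
      * exp (- (pi * v / real m) * (real_of_int r)\<^sup>2 + 4 * pi * v * \<bar>real_of_int r\<bar>))) summable_on UNIV"
    using m v by (intro summable_on_cmult_right summable_on_int_gaussian) auto
  have cont: "continuous_on {0..v} (\<lambda>y. q (r mod ?M) (t r y))" for r
    unfolding t_def by (intro continuous_on_compose2[OF q_cont[of UNIV]] continuous_intros) (use v in auto)
  note swap = has_sum_integral[of UNIV 0 v "\<lambda>r y. q (r mod ?M) (t r y)", OF cont bound summ]
  show "continuous_on {0..v} J"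
    by (rule swap(1)) (use sum in \<open>auto simp: t_def\<close>)
  define f where "f = (\<lambda>r. integral {0..v} (\<lambda>y. q (r mod ?M) (t r y)))"
  have "(f has_sum integral {0..v} J) UNIV"
    unfolding f_def by (rule swap(2)) (use sum in \<open>auto simp: t_def\<close>)
  moreover have bij: "bij_betw (\<lambda>(\<mu>, l). \<mu> + ?M * l) ({0..<?M} \<times> UNIV) UNIV"
    by (rule bij_betw_byWitness[where f' = "\<lambda>r. (r mod ?M, r div ?M)"]) (use M in auto)
  ultimately have S: "((\<lambda>(\<mu>, l). f (\<mu> + ?M * l)) has_sum integral {0..v} J) ({0..<?M} \<times> UNIV)"
    using has_sum_reindex_bij_betw[OF bij, of f] by (simp add: case_prod_beta')
  have q_int: "has_bochner_integral lborel (q \<mu>)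
     (of_real (sqrt (pi / \<alpha>)) * (c0 \<mu> + c2 \<mu> / of_real (2 * \<alpha>) + 3 * c4 \<mu> / of_real (4 * \<alpha>\<^sup>2)))" for \<mu>
    unfolding q_def by (rule gaussian_quartic_integral[OF \<alpha>])
  have inner: "((\<lambda>l. f (\<mu> + ?M * l)) has_sum of_real v * (LINT t|lborel. q \<mu> t)) UNIV" if \<mu>: "\<mu> \<in> {0..<?M}" for \<mu>
  proof -
    have "(\<lambda>l. f (\<mu> + ?M * l)) summable_on UNIV"
      by (rule summable_on_SigmaD1[OF has_sum_imp_summable[OF S] \<mu>])
    then have "((\<lambda>l. f (\<mu> + ?M * l)) has_sum (\<Sum>\<^sub>\<infinity>l. f (\<mu> + ?M * l))) UNIV"
      by (rule has_sum_infsum)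
    moreover from this have "((\<lambda>l. integral {0..v} (\<lambda>y. q \<mu> (real_of_int \<mu> / (2 * real m) + of_int l + y / v)))
        has_sum (\<Sum>\<^sub>\<infinity>l. f (\<mu> + ?M * l))) UNIV"
    proof (rule has_sum_cong[THEN iffD1, rotated])
      fix l
      have "(\<mu> + ?M * l) mod ?M = \<mu>" using \<mu> by simp
      moreover have "t (\<mu> + ?M * l) y = real_of_int \<mu> / (2 * real m) + of_int l + y / v" for y
        using m by (simp add: t_def add_divide_distrib)
      ultimately show "f (\<mu> + ?M * l) = integral {0..v} (\<lambda>y. q \<mu> (real_of_int \<mu> / (2 * real m) + of_int l + y / v))"
        by (simp add: f_def)
    qed
    then have "(\<Sum>\<^sub>\<infinity>l. f (\<mu> + ?M * l)) = of_real v * (LINT t|lborel. q \<mu> t)"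
      by (rule unfold_periodisation[OF q_cont integrable.intros[OF q_int] v])
    ultimately show ?thesis by simp
  qed
  have "((\<lambda>\<mu>. of_real v * (LINT t|lborel. q \<mu> t)) has_sum integral {0..v} J) {0..<?M}"
    by (rule has_sum_SigmaD[OF S]) (use inner in simp)
  then have "integral {0..v} J = (\<Sum>\<mu>\<in>{0..<?M}. of_real v * (LINT t|lborel. q \<mu> t))"
    by (rule has_sum_unique) simp
  also have "\<dots> = of_real (v * sqrt (pi / \<alpha>)) *
      (\<Sum>\<mu>\<in>{0..<?M}. c0 \<mu> + c2 \<mu> / of_real (2 * \<alpha>) + 3 * c4 \<mu> / of_real (4 * \<alpha>\<^sup>2))"
    unfolding has_bochner_integral_integral_eq[OF q_int] sum_distrib_left by (simp add: mult.assoc)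
  finally show "integral {0..v} J = \<dots>" .
qed

text \<open>
  After Parseval's identity in \<open>x\<close> the \<open>r\<close>-th term is a polynomial in \<open>t = r / (2 m) + y / v\<close> with terms of
  degree 0, 2 and 4 (\<open>c0\<close>, \<open>c2\<close>, \<open>c4\<close>), times \<open>exp (- 4 \<pi> m v t\<^sup>2)\<close>.  The moments contribute
  \<open>(k - 3/4) - k + 3/4 = 0\<close> to the coefficient of \<open>g cnj h\<close>, and turn \<open>k\<close> into \<open>k - 1/2\<close> in the terms with one
  derivative.
\<close>

lemma fibre_integral_DJ:
  fixes k m :: nat and \<phi> \<psi> :: "complex \<Rightarrow> complex \<Rightarrow> complex" and g h g' h' :: "int \<Rightarrow> complex \<Rightarrow> complex"
  assumes m: "m \<ge> 1" and \<phi>: "theta_expansion m \<phi> g" and \<psi>: "theta_expansion m \<psi> h"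
    and g: "\<And>\<mu> t. \<mu> \<in> {0..<2 * int m} \<Longrightarrow> Im t > 0 \<Longrightarrow> (g \<mu> has_field_derivative g' \<mu> t) (at t)"
    and h: "\<And>\<mu> t. \<mu> \<in> {0..<2 * int m} \<Longrightarrow> Im t > 0 \<Longrightarrow> (h \<mu> has_field_derivative h' \<mu> t) (at t)"
    and \<tau>: "Im \<tau> > 0"
  defines "F \<equiv> (\<lambda>\<tau> z. \<phi> \<tau> z * cnj (\<psi> \<tau> z)
                 * of_real (exp (- 4 * pi * real m * (Im z)\<^sup>2 / Im \<tau>) * Im \<tau> ^ k))"
  shows "continuous_on UNIV (DJ k F \<tau>)"
    and "(LINT z:fibre \<tau>|lborel. DJ k F \<tau> z) = of_real (Im \<tau> ^ k * (Im \<tau> * sqrt (1 / (4 * real m * Im \<tau>)))) *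
      (\<Sum>\<mu>\<in>{0..<2 * int m}. 4 * of_real (Im \<tau>)^2 * g' \<mu> \<tau> * cnj (h' \<mu> \<tau>)
        + 2 * \<i> * of_real (real k - 1/2) * of_real (Im \<tau>) * (g' \<mu> \<tau> * cnj (h \<mu> \<tau>) - g \<mu> \<tau> * cnj (h' \<mu> \<tau>)))"
proof -
  define v where "v = Im \<tau>"
  have v: "v > 0" using \<tau> by (simp add: v_def)
  let ?M = "2 * int m"
  define \<alpha> where "\<alpha> = 4 * pi * real m * v"
  have \<alpha>: "\<alpha> > 0" using m v by (simp add: \<alpha>_def)
  define P where "P = (\<lambda>z. theta_dtau m g g' \<tau> z + of_real (Im z / v) * theta_dz m g \<tau> z
       + \<i> / 2 * of_real (4 * pi * real m * (Im z / v)\<^sup>2) * \<phi> \<tau> z)"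
  define Q where "Q = (\<lambda>z. theta_dtau m h h' \<tau> z + of_real (Im z / v) * theta_dz m h \<tau> z
       + \<i> / 2 * of_real (4 * pi * real m * (Im z / v)\<^sup>2) * \<psi> \<tau> z)"
  define W where "W = (\<lambda>y. complex_of_real (exp (- (4 * pi * real m) * y\<^sup>2 / v) * v ^ k))"
  define L where "L = 2 * \<i> * of_nat k * complex_of_real v"
  define N where "N = complex_of_real (real k - 3/4)"
  note d\<phi> = theta_expansion_derivatives[OF \<phi> m g]
  note d\<psi> = theta_expansion_derivatives[OF \<psi> m h]
  have DJ: "DJ k F \<tau> z = W (Im z) * (4 * of_real v ^ 2 * (P z * cnj (Q z)) + L * (P z * cnj (\<psi> \<tau> z))
     + (- L) * (\<phi> \<tau> z * cnj (Q z)) + N * (\<phi> \<tau> z * cnj (\<psi> \<tau> z)))" for z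
  proof -
    have "F = (\<lambda>\<tau> z. \<phi> \<tau> z * cnj (\<psi> \<tau> z) * of_real (exp (- (4 * pi * real m) * (Im z)\<^sup>2 / Im \<tau>) * Im \<tau> ^ k))"
      by (simp add: F_def)
    then have "DJ k F \<tau> z = of_real (exp (- (4 * pi * real m) * (Im z)\<^sup>2 / Im \<tau>) * Im \<tau> ^ k) *
       (4 * of_real (Im \<tau>)^2 * P z * cnj (Q z)
        + 2 * \<i> * of_nat k * of_real (Im \<tau>) * (P z * cnj (\<psi> \<tau> z) - \<phi> \<tau> z * cnj (Q z))
        + of_real (real k - 3/4) * \<phi> \<tau> z * cnj (\<psi> \<tau> z))"
      unfolding P_def Q_def v_def
      by (simp only:) (rule DJ_formula[OF d\<phi>(1-3) d\<psi>(1-3) \<tau>])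
    then show ?thesis
      unfolding W_def L_def N_def v_def by (simp add: algebra_simps)
  qed
  have cont: "continuous_on UNIV (\<phi> \<tau>)" "continuous_on UNIV (\<psi> \<tau>)"
    "continuous_on UNIV (theta_dz m g \<tau>)" "continuous_on UNIV (theta_dz m h \<tau>)"
    "continuous_on UNIV (theta_dtau m g g' \<tau>)" "continuous_on UNIV (theta_dtau m h h' \<tau>)"
    using d\<phi>(2,4,5)[OF _ _ \<tau>] d\<psi>(2,4,5)[OF _ _ \<tau>]
    by (meson continuous_at_imp_continuous_on DERIV_isCont field_differentiable_imp_continuous_at)+
  show DJ_cont: "continuous_on UNIV (DJ k F \<tau>)"
    unfolding DJ W_def P_def Q_def by (intro continuous_intros cont) (use v in auto)

  define s where "s = (\<lambda>t. 2 * of_real pi * \<i> * of_nat m * complex_of_real (t\<^sup>2))"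
  define t where "t = (\<lambda>(r::int) y. real_of_int r / (2 * real m) + y / v)"
  define E where "E = (\<lambda>r y. e ((of_int r)\<^sup>2 / (4 * of_nat m) * \<tau> + of_int r * (\<i> * of_real y)))"
  define c0 where "c0 = (\<lambda>\<mu>. 4 * of_real v ^ 2 * (g' \<mu> \<tau> * cnj (h' \<mu> \<tau>))
     + L * (g' \<mu> \<tau> * cnj (h \<mu> \<tau>) - g \<mu> \<tau> * cnj (h' \<mu> \<tau>)) + N * (g \<mu> \<tau> * cnj (h \<mu> \<tau>)))"
  define c2 where "c2 = (\<lambda>\<mu>. 8 * of_real pi * \<i> * of_nat m * of_real v ^ 2 * (g \<mu> \<tau> * cnj (h' \<mu> \<tau>) - g' \<mu> \<tau> * cnj (h \<mu> \<tau>))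
     + 4 * of_real pi * \<i> * of_nat m * L * (g \<mu> \<tau> * cnj (h \<mu> \<tau>)))"
  define c4 where "c4 = (\<lambda>\<mu>. 16 * of_real pi ^ 2 * of_nat m ^ 2 * of_real v ^ 2 * (g \<mu> \<tau> * cnj (h \<mu> \<tau>)))"
  define q where "q = (\<lambda>\<mu> t. (c0 \<mu> + c2 \<mu> * of_real (t\<^sup>2) + c4 \<mu> * of_real (t ^ 4)) * of_real (exp (- \<alpha> * t\<^sup>2)))"
  have E_split: "e ((of_int r)\<^sup>2 / (4 * of_nat m) * \<tau> + of_int r * Complex x y) = E r y * e (of_int r * of_real x)" for r x y
    unfolding E_def e_add[symmetric] by (simp add: Complex_eq algebra_simps)
  \<comment> \<open>Completing the square in the exponent.\<close>
  have WE: "W y * (E r y * cnj (E r y)) = of_real (v ^ k) * of_real (exp (- \<alpha> * (t r y)\<^sup>2))" for r y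
  proof -
    have "E r y * cnj (E r y) = of_real ((norm (E r y))\<^sup>2)"
      by (rule complex_norm_square[symmetric])
    also have "norm (E r y) = exp (- 2 * pi * ((real_of_int r)\<^sup>2 / (4 * real m) * v + real_of_int r * y))"
    proof -
      have eq: "(of_int r)\<^sup>2 / (4 * of_nat m) * \<tau> = complex_of_real ((real_of_int r)\<^sup>2 / (4 * real m)) * \<tau>"
        by simp
      show ?thesis unfolding E_def norm_e eq v_def by simp
    qed
    also have "(exp (- 2 * pi * ((real_of_int r)\<^sup>2 / (4 * real m) * v + real_of_int r * y)))\<^sup>2
      = exp (- 4 * pi * ((real_of_int r)\<^sup>2 / (4 * real m) * v + real_of_int r * y))"
      by (simp add: power2_eq_square flip: exp_add)
    finally have "W y * (E r y * cnj (E r y)) = of_real (v ^ k) * of_real (exp (- (4 * pi * real m) * y\<^sup>2 / v)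
       * exp (- 4 * pi * ((real_of_int r)\<^sup>2 / (4 * real m) * v + real_of_int r * y)))"
      by (simp add: W_def)
    also have "exp (- (4 * pi * real m) * y\<^sup>2 / v) * exp (- 4 * pi * ((real_of_int r)\<^sup>2 / (4 * real m) * v + real_of_int r * y))
      = exp (- \<alpha> * (t r y)\<^sup>2)"
    proof -
      have "- (4 * pi * real m) * y\<^sup>2 / v + - 4 * pi * ((real_of_int r)\<^sup>2 / (4 * real m) * v + real_of_int r * y)
        = - \<alpha> * (t r y)\<^sup>2"
        using v m by (simp add: \<alpha>_def t_def field_simps power2_eq_square)
      then show ?thesis by (simp flip: exp_add)
    qed
    finally show ?thesis .
  qed
  define J where "J = (\<lambda>y. integral {0..1} (\<lambda>x. DJ k F \<tau> (Complex x y)))"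
  have J: "((\<lambda>r. of_real (v ^ k) * q (r mod ?M) (t r y)) has_sum J y) UNIV" for y
  proof -
    define A where "A = (\<lambda>r. g (r mod ?M) \<tau> * E r y)"
    define A' where "A' = (\<lambda>r. (g' (r mod ?M) \<tau> + s (t r y) * g (r mod ?M) \<tau>) * E r y)"
    define B where "B = (\<lambda>r. h (r mod ?M) \<tau> * E r y)"
    define B' where "B' = (\<lambda>r. (h' (r mod ?M) \<tau> + s (t r y) * h (r mod ?M) \<tau>) * E r y)"
    have A: "((\<lambda>r. A r * e (of_int r * of_real x)) has_sum \<phi> \<tau> (Complex x y)) UNIV" for x
      using theta_expansion_has_sum[OF \<phi> m \<tau>, of "Complex x y"] unfolding E_split A_def by (simp add: mult.assoc)
    have B: "((\<lambda>r. B r * e (of_int r * of_real x)) has_sum \<psi> \<tau> (Complex x y)) UNIV" for x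
      using theta_expansion_has_sum[OF \<psi> m \<tau>, of "Complex x y"] unfolding E_split B_def by (simp add: mult.assoc)
    have A': "((\<lambda>r. A' r * e (of_int r * of_real x)) has_sum P (Complex x y)) UNIV" for x
      using completed_square_has_sum[OF \<phi> m \<tau>, of g' "y / v" "Complex x y"]
      unfolding E_split A'_def P_def s_def t_def by (simp add: mult.assoc)
    have B': "((\<lambda>r. B' r * e (of_int r * of_real x)) has_sum Q (Complex x y)) UNIV" for x
      using completed_square_has_sum[OF \<psi> m \<tau>, of h' "y / v" "Complex x y"]
      unfolding E_split B'_def Q_def s_def t_def by (simp add: mult.assoc)
    note parts = parseval[OF A' B'] parseval[OF A' B] parseval[OF A B'] parseval[OF A B]
    note ints = parts(2,4,6,8)[THEN integrable_continuous_interval, THEN integrable_integral]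
    have "((\<lambda>x. W y * (4 * of_real v ^ 2 * (P (Complex x y) * cnj (Q (Complex x y))) + L * (P (Complex x y) * cnj (\<psi> \<tau> (Complex x y)))
       + (- L) * (\<phi> \<tau> (Complex x y) * cnj (Q (Complex x y))) + N * (\<phi> \<tau> (Complex x y) * cnj (\<psi> \<tau> (Complex x y)))))
      has_integral W y * (4 * of_real v ^ 2 * integral {0..1} (\<lambda>x. P (Complex x y) * cnj (Q (Complex x y)))
       + L * integral {0..1} (\<lambda>x. P (Complex x y) * cnj (\<psi> \<tau> (Complex x y)))
       + (- L) * integral {0..1} (\<lambda>x. \<phi> \<tau> (Complex x y) * cnj (Q (Complex x y)))
       + N * integral {0..1} (\<lambda>x. \<phi> \<tau> (Complex x y) * cnj (\<psi> \<tau> (Complex x y))))) {0..1}"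
      by (intro has_integral_mult_right has_integral_add ints)
    then have "(DJ k F \<tau> \<circ> (\<lambda>x. Complex x y) has_integral W y * (4 * of_real v ^ 2 * integral {0..1} (\<lambda>x. P (Complex x y) * cnj (Q (Complex x y)))
       + L * integral {0..1} (\<lambda>x. P (Complex x y) * cnj (\<psi> \<tau> (Complex x y)))
       + (- L) * integral {0..1} (\<lambda>x. \<phi> \<tau> (Complex x y) * cnj (Q (Complex x y)))
       + N * integral {0..1} (\<lambda>x. \<phi> \<tau> (Complex x y) * cnj (\<psi> \<tau> (Complex x y))))) {0..1}"
      unfolding o_def DJ complex.sel .
    then have J_eq: "J y = W y * (4 * of_real v ^ 2 * integral {0..1} (\<lambda>x. P (Complex x y) * cnj (Q (Complex x y)))
       + L * integral {0..1} (\<lambda>x. P (Complex x y) * cnj (\<psi> \<tau> (Complex x y)))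
       + (- L) * integral {0..1} (\<lambda>x. \<phi> \<tau> (Complex x y) * cnj (Q (Complex x y)))
       + N * integral {0..1} (\<lambda>x. \<phi> \<tau> (Complex x y) * cnj (\<psi> \<tau> (Complex x y))))"
      unfolding J_def o_def by (rule integral_unique)
    have "((\<lambda>r. W y * (4 * of_real v ^ 2 * (A' r * cnj (B' r)) + L * (A' r * cnj (B r))
       + (- L) * (A r * cnj (B' r)) + N * (A r * cnj (B r)))) has_sum J y) UNIV"
      unfolding J_eq by (intro has_sum_cmult_right has_sum_add parts(1,3,5,7))
    moreover have "W y * (4 * of_real v ^ 2 * (A' r * cnj (B' r)) + L * (A' r * cnj (B r))
       + (- L) * (A r * cnj (B' r)) + N * (A r * cnj (B r))) = of_real (v ^ k) * q (r mod ?M) (t r y)" for r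
    proof -
      define a a' b b' w w' where "a = g (r mod ?M) \<tau>" and "a' = g' (r mod ?M) \<tau>"
        and "b = cnj (h (r mod ?M) \<tau>)" and "b' = cnj (h' (r mod ?M) \<tau>)"
        and "w = E r y" and "w' = cnj (E r y)"
      \<comment> \<open>\<open>\<sigma>\<close> is purely imaginary, which produces the signs below.\<close>
      define \<sigma> where "\<sigma> = s (t r y)"
      have cs: "cnj \<sigma> = - \<sigma>" by (simp add: \<sigma>_def s_def)
      have "W y * (4 * of_real v ^ 2 * (A' r * cnj (B' r)) + L * (A' r * cnj (B r))
         + (- L) * (A r * cnj (B' r)) + N * (A r * cnj (B r)))
        = W y * (4 * of_real v ^ 2 * (((a' + \<sigma> * a) * w) * ((b' - \<sigma> * b) * w')) + L * (((a' + \<sigma> * a) * w) * (b * w'))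
         + (- L) * ((a * w) * ((b' - \<sigma> * b) * w')) + N * ((a * w) * (b * w')))"
        by (simp add: A_def A'_def B_def B'_def a_def a'_def b_def b'_def w_def w'_def cs flip: \<sigma>_def)
      also have "\<dots> = W y * (w * w') * (4 * of_real v ^ 2 * (a' * b') + L * (a' * b - a * b') + N * (a * b)
          + (4 * of_real v ^ 2 * (a * b' - a' * b) + 2 * L * (a * b)) * \<sigma> - 4 * of_real v ^ 2 * (a * b) * \<sigma>\<^sup>2)"
        by (simp add: algebra_simps power2_eq_square)
      also have "W y * (w * w') = of_real (v ^ k) * of_real (exp (- \<alpha> * (t r y)\<^sup>2))"
        unfolding w_def w'_def by (rule WE)
      also have "4 * of_real v ^ 2 * (a' * b') + L * (a' * b - a * b') + N * (a * b)
          + (4 * of_real v ^ 2 * (a * b' - a' * b) + 2 * L * (a * b)) * \<sigma> - 4 * of_real v ^ 2 * (a * b) * \<sigma>\<^sup>2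
        = c0 (r mod ?M) + c2 (r mod ?M) * of_real ((t r y)\<^sup>2) + c4 (r mod ?M) * of_real (t r y ^ 4)"
      proof -
        have \<sigma>2: "\<sigma>\<^sup>2 = - (4 * of_real pi ^ 2 * of_nat m ^ 2 * complex_of_real (t r y ^ 4))"
          by (simp add: \<sigma>_def s_def power2_eq_square power4_eq_xxxx)
        show ?thesis
          unfolding \<sigma>2 c0_def c2_def c4_def a_def[symmetric] a'_def[symmetric] b_def[symmetric] b'_def[symmetric]
          by (simp add: \<sigma>_def s_def algebra_simps)
      qed
      finally show ?thesis by (simp add: q_def mult_ac)
    qed
    ultimately show ?thesis by simp
  qed
  define J' where "J' = (\<lambda>y. J y / of_real (v ^ k))"
  have vk: "complex_of_real (v ^ k) \<noteq> 0" using v by simp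
  have J': "((\<lambda>r. q (r mod ?M) (of_int r / (2 * real m) + y / v)) has_sum J' y) UNIV" for y
    using J[of y] vk unfolding J'_def has_sum_cmult_right_iff[OF vk] by (simp add: t_def)
  note unf = theta_unfolding[of m v c0 c2 c4 J', folded \<alpha>_def, OF m v J'[unfolded q_def]]
  have JJ': "J = (\<lambda>y. of_real (v ^ k) * J' y)" using vk by (simp add: J'_def fun_eq_iff)
  have J_cont: "continuous_on {0..v} J"
    unfolding JJ' by (intro continuous_intros unf(1))
  have "(LINT z:fibre \<tau>|lborel. DJ k F \<tau> z) = integral {0..v} J"
    using LINT_fibre_eq_iterated[OF DJ_cont, of \<tau>] J_cont by (simp add: J_def v_def)
  also have "\<dots> = of_real (v ^ k) * integral {0..v} J'"
    unfolding JJ' by (rule integral_mult_right)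
  also have "\<dots> = of_real (v ^ k) * (of_real (v * sqrt (pi / \<alpha>)) *
      (\<Sum>\<mu>\<in>{0..<?M}. c0 \<mu> + c2 \<mu> / of_real (2 * \<alpha>) + 3 * c4 \<mu> / of_real (4 * \<alpha>\<^sup>2)))"
    unfolding unf(2) ..
  also have "(\<lambda>\<mu>. c0 \<mu> + c2 \<mu> / of_real (2 * \<alpha>) + 3 * c4 \<mu> / of_real (4 * \<alpha>\<^sup>2))
     = (\<lambda>\<mu>. 4 * of_real v ^ 2 * g' \<mu> \<tau> * cnj (h' \<mu> \<tau>)
        + 2 * \<i> * of_real (real k - 1/2) * of_real v * (g' \<mu> \<tau> * cnj (h \<mu> \<tau>) - g \<mu> \<tau> * cnj (h' \<mu> \<tau>)))"
  proof
    fix \<mu>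
    define a a' b b' where "a = g \<mu> \<tau>" and "a' = g' \<mu> \<tau>" and "b = cnj (h \<mu> \<tau>)" and "b' = cnj (h' \<mu> \<tau>)"
    note ab = a_def[symmetric] a'_def[symmetric] b_def[symmetric] b'_def[symmetric]
    have c2: "c2 \<mu> / of_real (2 * \<alpha>) = \<i> * of_real v * (a * b' - a' * b) - of_nat k * (a * b)"
      using m v unfolding c2_def L_def \<alpha>_def ab by (simp add: field_simps power2_eq_square)
    have c4: "3 * c4 \<mu> / of_real (4 * \<alpha>\<^sup>2) = 3 / 4 * (a * b)"
      using m v unfolding c4_def \<alpha>_def ab by (simp add: field_simps power2_eq_square)
    show "c0 \<mu> + c2 \<mu> / of_real (2 * \<alpha>) + 3 * c4 \<mu> / of_real (4 * \<alpha>\<^sup>2)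
      = 4 * of_real v ^ 2 * g' \<mu> \<tau> * cnj (h' \<mu> \<tau>)
        + 2 * \<i> * of_real (real k - 1/2) * of_real v * (g' \<mu> \<tau> * cnj (h \<mu> \<tau>) - g \<mu> \<tau> * cnj (h' \<mu> \<tau>))"
      unfolding c2 c4 unfolding c0_def ab by (simp add: L_def N_def algebra_simps)
  qed
  also have "pi / \<alpha> = 1 / (4 * real m * v)"
    by (simp add: \<alpha>_def)
  finally show "(LINT z:fibre \<tau>|lborel. DJ k F \<tau> z) = of_real (Im \<tau> ^ k * (Im \<tau> * sqrt (1 / (4 * real m * Im \<tau>)))) *
      (\<Sum>\<mu>\<in>{0..<2 * int m}. 4 * of_real (Im \<tau>)^2 * g' \<mu> \<tau> * cnj (h' \<mu> \<tau>)
        + 2 * \<i> * of_real (real k - 1/2) * of_real (Im \<tau>) * (g' \<mu> \<tau> * cnj (h \<mu> \<tau>) - g \<mu> \<tau> * cnj (h' \<mu> \<tau>)))"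
    unfolding v_def by (simp add: mult.assoc)
qed

section \<open>Integration over the fundamental domain\<close>

lemma power_le_fact_mult_exp:
  fixes x :: real
  assumes "x \<ge> 0"
  shows "x ^ n \<le> fact n * exp x"
proof -
  have "(\<Sum>j\<in>{n}. inverse (fact j) * x ^ j) \<le> exp x"
    unfolding exp_def using assms summable_exp[of x]
    by (subst real_scaleR_def[symmetric]) (intro sum_le_suminf, auto)
  then show ?thesis by (simp add: field_simps)
qed

lemma fund_dom_sets [measurable]: "fund_dom \<in> sets borel"
  unfolding fund_dom_def by measurable

lemma fund_dom_Im_ge: "\<tau> \<in> fund_dom \<Longrightarrow> Im \<tau> \<ge> 1/2"
proof -
  assume "\<tau> \<in> fund_dom"
  then have *: "Im \<tau> > 0" "\<bar>Re \<tau>\<bar> \<le> 1/2" "cmod \<tau> \<ge> 1" by (auto simp: fund_dom_def)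
  have "1 \<le> \<bar>Re \<tau>\<bar> + \<bar>Im \<tau>\<bar>" using *(3) cmod_le[of \<tau>] by linarith
  with * show ?thesis by simp
qed

text \<open>
  The fundamental domain lies in a strip of width one, so exponential decay in \<open>Im \<tau>\<close> beats any power.
\<close>

lemma set_integrable_fund_dom_exp_decay:
  fixes f :: "complex \<Rightarrow> complex"
  assumes cont: "continuous_on fund_dom f" and c: "c > 0"
    and bound: "\<And>\<tau>. \<tau> \<in> fund_dom \<Longrightarrow> norm (f \<tau>) \<le> B * (Im \<tau> ^ n * exp (- c * Im \<tau>))"
  shows "set_integrable lborel fund_dom f"
proof -
  define b where "b = (\<lambda>y. indicator {0<..} y * exp (- (y * (c / 2))) :: real)"
  define A where "A = \<bar>B\<bar> * ((2 / c) ^ n * fact n)"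
  have "integrable lborel (\<lambda>x::real. indicator {-1/2..1/2} x :: real)"
    by simp
  moreover have "integrable lborel b"
    using integrable_I0i_exp_mscale[of "c / 2"] c by (simp add: b_def set_integrable_def)
  ultimately have "integrable (lborel :: complex measure) (\<lambda>z. indicator {-1/2..1/2} (Re z) * b (Im z))"
    by (rule integrable_lborel_complex_product)
  then have "integrable (lborel :: complex measure) (\<lambda>z. A * (indicator {-1/2..1/2} (Re z) * b (Im z)))"
    by (rule integrable_mult_right)
  then show ?thesis
    unfolding set_integrable_def
  proof (rule Bochner_Integration.integrable_bound)
    show "(\<lambda>\<tau>. indicator fund_dom \<tau> *\<^sub>R f \<tau>) \<in> borel_measurable lborel"
      using borel_measurable_continuous_on_indicator[OF fund_dom_sets cont] by simp
    have "norm (indicator fund_dom \<tau> *\<^sub>R f \<tau>) \<le> norm (A * (indicator {-1/2..1/2} (Re \<tau>) * b (Im \<tau>)))" for \<tau>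
    proof (cases "\<tau> \<in> fund_dom")
      case True
      then have \<tau>: "Im \<tau> > 0" "Re \<tau> \<in> {-1/2..1/2}" by (auto simp: fund_dom_def abs_le_iff)
      have "(c / 2 * Im \<tau>) ^ n \<le> fact n * exp (c / 2 * Im \<tau>)"
        using c \<tau> by (intro power_le_fact_mult_exp) auto
      then have "(2 / c) ^ n * (c / 2 * Im \<tau>) ^ n \<le> (2 / c) ^ n * (fact n * exp (c / 2 * Im \<tau>))"
        using c by (intro mult_left_mono) auto
      moreover have "(2 / c) ^ n * (c / 2 * Im \<tau>) ^ n = Im \<tau> ^ n"
        using c by (simp flip: power_mult_distrib)
      ultimately have pow: "Im \<tau> ^ n \<le> (2 / c) ^ n * fact n * exp (c / 2 * Im \<tau>)"
        by (simp add: mult.assoc)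
      have "norm (f \<tau>) \<le> \<bar>B\<bar> * (Im \<tau> ^ n * exp (- c * Im \<tau>))"
        using bound[OF True] \<tau>(1) by (smt (verit) abs_ge_self exp_ge_zero mult_nonneg_nonneg mult_right_mono zero_le_power)
      also have "\<dots> \<le> \<bar>B\<bar> * ((2 / c) ^ n * fact n * exp (c / 2 * Im \<tau>) * exp (- c * Im \<tau>))"
        by (intro mult_left_mono mult_right_mono pow) auto
      also have "\<dots> = A * (exp (c / 2 * Im \<tau>) * exp (- c * Im \<tau>))"
        by (simp add: A_def mult_ac)
      also have "exp (c / 2 * Im \<tau>) * exp (- c * Im \<tau>) = b (Im \<tau>)"
        using \<tau> by (simp add: b_def field_simps flip: exp_add)
      finally show ?thesis
        using True \<tau> by simp
    qed simp
    then show "AE \<tau> in lborel. norm (indicator fund_dom \<tau> *\<^sub>R f \<tau>) \<le> norm (A * (indicator {-1/2..1/2} (Re \<tau>) * b (Im \<tau>)))"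
      by simp
  qed
qed

text \<open>
  The integrand is the right hand side of \<open>DD_formula\<close> divided by \<open>v\<^sup>2\<close>.  Each term has at least one
  differentiated factor, and that factor decays exponentially while the other one stays bounded.
\<close>

lemma set_integrable_fund_dom_sesquilinear:
  fixes g g' h h' :: "complex \<Rightarrow> complex" and \<kappa> :: real
  assumes g: "\<And>t. Im t > 0 \<Longrightarrow> (g has_field_derivative g' t) (at t)"
    and h: "\<And>t. Im t > 0 \<Longrightarrow> (h has_field_derivative h' t) (at t)"
    and gb: "c > 0" "\<And>t. Im t \<ge> 1/2 \<Longrightarrow> norm (g t) \<le> K \<and> norm (g' t) \<le> K * exp (- c * Im t)"
    and hb: "d > 0" "\<And>t. Im t \<ge> 1/2 \<Longrightarrow> norm (h t) \<le> M \<and> norm (h' t) \<le> M * exp (- d * Im t)"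
  shows "set_integrable lborel fund_dom (\<lambda>t. of_real (Im t powr \<kappa>) * (4 * of_real (Im t)^2 * g' t * cnj (h' t)
      + 2 * \<i> * of_real \<kappa> * of_real (Im t) * (g' t * cnj (h t) - g t * cnj (h' t))) / of_real ((Im t)\<^sup>2))"
proof -
  define b where "b = min c d"
  \<comment> \<open>Any natural number at least \<open>|\<kappa>|\<close> works as the exponent in the majorant.\<close>
  define n where "n = nat \<lceil>\<bar>\<kappa>\<bar>\<rceil>"
  have "norm (g \<i>) \<le> K" "norm (h \<i>) \<le> M"
    using gb(2)[of \<i>] hb(2)[of \<i>] by simp_all
  then have K: "K \<ge> 0" "M \<ge> 0"
    by (auto intro: order_trans[OF norm_ge_zero])
  have up: "t \<in> fund_dom \<Longrightarrow> Im t > 0" for t by (simp add: fund_dom_def)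
  have cont: "continuous_on fund_dom g" "continuous_on fund_dom g'" "continuous_on fund_dom h" "continuous_on fund_dom h'"
  proof -
    have "continuous_on fund_dom f" if "\<And>t. Im t > 0 \<Longrightarrow> (f has_field_derivative f' t) (at t)" for f f' :: "complex \<Rightarrow> complex"
      by (intro continuous_at_imp_continuous_on ballI DERIV_isCont[OF that] up)
    moreover have "(g' has_field_derivative deriv g' t) (at t)" "(h' has_field_derivative deriv h' t) (at t)" if "Im t > 0" for t
      by (rule has_field_derivative_deriv_of_holomorphic[OF open_upper_half]; use g h that in auto)+
    ultimately show "continuous_on fund_dom g" "continuous_on fund_dom g'" "continuous_on fund_dom h" "continuous_on fund_dom h'"
      using g h by blast+
  qed
  show ?thesis
  proof (rule set_integrable_fund_dom_exp_decay[where c = b and n = n and B = "4 ^ n * (4 + 8 * \<bar>\<kappa>\<bar>) * (K * M)"])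
    show "b > 0" using gb hb by (simp add: b_def)
    show "continuous_on fund_dom (\<lambda>t. of_real (Im t powr \<kappa>) * (4 * of_real (Im t)^2 * g' t * cnj (h' t)
      + 2 * \<i> * of_real \<kappa> * of_real (Im t) * (g' t * cnj (h t) - g t * cnj (h' t))) / of_real ((Im t)\<^sup>2))"
      by (intro continuous_intros cont) (use up in force)+
  next
    fix t assume t: "t \<in> fund_dom"
    define v where "v = Im t"
    have v: "v \<ge> 1/2" using fund_dom_Im_ge[OF t] by (simp add: v_def)
    define x where "x = exp (- b * v)"
    have x: "0 < x" "x \<le> 1" using v gb hb by (auto simp: x_def b_def)
    note gt = gb(2)[of t] and ht = hb(2)[of t]
    have g't: "norm (g' t) \<le> K * x"
    proof -
      have "norm (g' t) \<le> K * exp (- c * v)" using gt v by (simp add: v_def)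
      also have "\<dots> \<le> K * x" unfolding x_def b_def using v K by (intro mult_left_mono) (auto intro: mult_right_mono)
      finally show ?thesis .
    qed
    have h't: "norm (h' t) \<le> M * x"
    proof -
      have "norm (h' t) \<le> M * exp (- d * v)" using ht v by (simp add: v_def)
      also have "\<dots> \<le> M * x" unfolding x_def b_def using v K by (intro mult_left_mono) (auto intro: mult_right_mono)
      finally show ?thesis .
    qed
    have gt0: "norm (g t) \<le> K" and ht0: "norm (h t) \<le> M" using gt ht v by (auto simp: v_def)
    have 1: "norm (g' t * cnj (h' t)) \<le> K * M * x"
    proof -
      have "norm (g' t * cnj (h' t)) \<le> (K * x) * (M * x)"
        unfolding norm_mult complex_mod_cnj using g't h't K x by (intro mult_mono) auto
      also have "\<dots> \<le> (K * x) * (M * 1)" using K x by (intro mult_left_mono) auto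
      finally show ?thesis by (simp add: mult_ac)
    qed
    have 2: "norm (g' t * cnj (h t) - g t * cnj (h' t)) \<le> 2 * (K * M * x)"
    proof -
      have "norm (g' t * cnj (h t)) \<le> (K * x) * M" "norm (g t * cnj (h' t)) \<le> K * (M * x)"
        unfolding norm_mult complex_mod_cnj using g't h't gt0 ht0 K x by (intro mult_mono; simp)+
      then show ?thesis
        using norm_triangle_ineq4[of "g' t * cnj (h t)" "g t * cnj (h' t)"] by (simp add: mult_ac)
    qed
    have "norm (4 * of_real v ^ 2 * g' t * cnj (h' t)
        + 2 * \<i> * of_real \<kappa> * of_real v * (g' t * cnj (h t) - g t * cnj (h' t)))
      \<le> 4 * v ^ 2 * (K * M * x) + 2 * \<bar>\<kappa>\<bar> * v * (2 * (K * M * x))"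
    proof (rule norm_triangle_mono)
      have "norm (4 * of_real v ^ 2 * g' t * cnj (h' t)) = 4 * v ^ 2 * norm (g' t * cnj (h' t))"
        by (simp add: norm_mult norm_power)
      also have "\<dots> \<le> 4 * v ^ 2 * (K * M * x)" using 1 by (intro mult_left_mono) auto
      finally show "norm (4 * of_real v ^ 2 * g' t * cnj (h' t)) \<le> 4 * v ^ 2 * (K * M * x)" .
      have "norm (2 * \<i> * of_real \<kappa> * of_real v * (g' t * cnj (h t) - g t * cnj (h' t)))
         = 2 * \<bar>\<kappa>\<bar> * v * norm (g' t * cnj (h t) - g t * cnj (h' t))"
        using v by (simp add: norm_mult)
      also have "\<dots> \<le> 2 * \<bar>\<kappa>\<bar> * v * (2 * (K * M * x))" using 2 v by (intro mult_left_mono) auto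
      finally show "norm (2 * \<i> * of_real \<kappa> * of_real v * (g' t * cnj (h t) - g t * cnj (h' t)))
         \<le> 2 * \<bar>\<kappa>\<bar> * v * (2 * (K * M * x))" .
    qed
    also have "\<dots> \<le> v ^ 2 * ((4 + 8 * \<bar>\<kappa>\<bar>) * (K * M * x))"
    proof -
      have "v * 1 \<le> v * (2 * v)" using v by (intro mult_left_mono) auto
      then have "4 * \<bar>\<kappa>\<bar> * v * (K * M * x) \<le> 4 * \<bar>\<kappa>\<bar> * (2 * v ^ 2) * (K * M * x)"
        using K x by (intro mult_right_mono mult_left_mono) (auto simp: power2_eq_square)
      then show ?thesis by (simp add: algebra_simps)
    qed
    finally have main: "norm (4 * of_real v ^ 2 * g' t * cnj (h' t)
        + 2 * \<i> * of_real \<kappa> * of_real v * (g' t * cnj (h t) - g t * cnj (h' t))) \<le> v ^ 2 * ((4 + 8 * \<bar>\<kappa>\<bar>) * (K * M * x))" .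
    \<comment> \<open>Monotonicity in the exponent needs a base at least 1, hence the detour through \<open>2 v\<close>.\<close>
    have pw: "v powr \<kappa> \<le> 4 ^ n * v ^ n"
    proof -
      have \<kappa>: "\<bar>\<kappa>\<bar> \<le> real n" unfolding n_def by linarith
      have "v powr \<kappa> \<le> (2 * v) powr \<kappa> * 2 powr \<bar>\<kappa>\<bar>"
      proof -
        have "v powr \<kappa> = (2 * v) powr \<kappa> * 2 powr (- \<kappa>)"
          using v by (simp add: powr_mult powr_minus field_simps)
        also have "\<dots> \<le> (2 * v) powr \<kappa> * 2 powr \<bar>\<kappa>\<bar>"
          by (intro mult_left_mono powr_mono) auto
        finally show ?thesis .
      qed
      also have "\<dots> \<le> (2 * v) powr real n * 2 powr real n"
        using v \<kappa> by (intro mult_mono powr_mono) auto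
      also have "\<dots> = 4 ^ n * v ^ n"
      proof -
        have "(2 * v) powr real n * 2 powr real n = (2 * v) ^ n * 2 ^ n"
          using v by (simp only: powr_realpow zero_less_numeral mult_pos_pos less_le_trans[OF _ v])
        also have "\<dots> = (2 * v * 2) ^ n" by (rule power_mult_distrib[symmetric])
        also have "2 * v * 2 = 4 * v" by simp
        finally show ?thesis by (simp only: power_mult_distrib)
      qed
      finally show ?thesis .
    qed
    have "norm (of_real (v powr \<kappa>) * (4 * of_real v ^ 2 * g' t * cnj (h' t)
        + 2 * \<i> * of_real \<kappa> * of_real v * (g' t * cnj (h t) - g t * cnj (h' t))) / of_real (v\<^sup>2))
      = v powr \<kappa> * norm (4 * of_real v ^ 2 * g' t * cnj (h' t)
        + 2 * \<i> * of_real \<kappa> * of_real v * (g' t * cnj (h t) - g t * cnj (h' t))) / v\<^sup>2"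
      by (simp only: norm_divide norm_mult norm_of_real abs_power2 abs_of_nonneg[OF powr_ge_zero])
    also have "\<dots> \<le> (4 ^ n * v ^ n) * (v ^ 2 * ((4 + 8 * \<bar>\<kappa>\<bar>) * (K * M * x))) / v\<^sup>2"
      by (intro divide_right_mono mult_mono pw main) (use v in auto)
    also have "\<dots> = 4 ^ n * (4 + 8 * \<bar>\<kappa>\<bar>) * (K * M) * (v ^ n * x)"
      using v by (simp add: field_simps)
    finally show "norm (of_real (Im t powr \<kappa>) * (4 * of_real (Im t)^2 * g' t * cnj (h' t)
      + 2 * \<i> * of_real \<kappa> * of_real (Im t) * (g' t * cnj (h t) - g t * cnj (h' t))) / of_real ((Im t)\<^sup>2))
      \<le> 4 ^ n * (4 + 8 * \<bar>\<kappa>\<bar>) * (K * M) * (Im t ^ n * exp (- b * Im t))"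
      unfolding v_def x_def .
  qed
qed

theorem proposition3p3:
  fixes k m :: nat
    and \<phi> \<psi> :: "complex \<Rightarrow> complex \<Rightarrow> complex"
    and g h :: "int \<Rightarrow> complex \<Rightarrow> complex"
  assumes "even k" and "k > 0" and "m \<ge> 1"
    and "jacobi_form k m \<phi>" and "jacobi_form k m \<psi>"
    and "theta_expansion m \<phi> g" and "theta_expansion m \<psi> h"
  defines "F \<equiv> (\<lambda>\<tau> z. \<phi> \<tau> z * cnj (\<psi> \<tau> z)
                 * of_real (exp (- 4 * pi * real m * (Im z)\<^sup>2 / Im \<tau>) * Im \<tau> ^ k))"
    and "G \<equiv> (\<lambda>\<tau>. \<Sum>\<mu>\<in>{0..<2 * int m}.
                 DD (real k - 1/2) (\<lambda>t. g \<mu> t * cnj (h \<mu> t) * of_real (Im t powr (real k - 1/2))) \<tau>)"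
  shows "jacobi_integrable (DJ k F) \<and> modular_integrable G \<and>
         jacobi_integral (DJ k F) = of_real (1 / sqrt (4 * real m)) * modular_integral G"
proof -
  define \<kappa> where "\<kappa> = real k - 1/2"
  have m: "m \<ge> 1" by fact
  note g = jacobi_form_theta_coefficient(1)[OF assms(4) assms(6) m]
  note h = jacobi_form_theta_coefficient(1)[OF assms(5) assms(7) m]
  define T where "T = (\<lambda>\<mu> t. 4 * of_real (Im t)^2 * deriv (g \<mu>) t * cnj (deriv (h \<mu>) t)
      + 2 * \<i> * of_real \<kappa> * of_real (Im t) * (deriv (g \<mu>) t * cnj (h \<mu> t) - g \<mu> t * cnj (deriv (h \<mu>) t)))"
  have up: "t \<in> fund_dom \<Longrightarrow> Im t > 0" for t by (simp add: fund_dom_def)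
  have G: "G t = (\<Sum>\<mu>\<in>{0..<2 * int m}. of_real (Im t powr \<kappa>) * T \<mu> t)" if "Im t > 0" for t
    unfolding G_def T_def \<kappa>_def
    by (intro sum.cong refl DD_formula) (use g h that in auto)
  have "set_integrable lborel fund_dom (\<lambda>t. of_real (Im t powr \<kappa>) * T \<mu> t / of_real ((Im t)\<^sup>2))"
    if \<mu>: "\<mu> \<in> {0..<2 * int m}" for \<mu>
  proof -
    obtain K c where gb: "c > 0" "\<And>t. Im t \<ge> 1/2 \<Longrightarrow> norm (g \<mu> t) \<le> K \<and> norm (deriv (g \<mu>) t) \<le> K * exp (- c * Im t)"
      using jacobi_form_theta_coefficient(2)[OF assms(4) assms(6) m \<mu>] by blast
    obtain M d where hb: "d > 0" "\<And>t. Im t \<ge> 1/2 \<Longrightarrow> norm (h \<mu> t) \<le> M \<and> norm (deriv (h \<mu>) t) \<le> M * exp (- d * Im t)"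
      using jacobi_form_theta_coefficient(2)[OF assms(5) assms(7) m \<mu>] by blast
    show ?thesis
      unfolding T_def
      by (rule set_integrable_fund_dom_sesquilinear[where g = "g \<mu>" and g' = "deriv (g \<mu>)" and h = "h \<mu>"
            and h' = "deriv (h \<mu>)", OF g[OF \<mu>] h[OF \<mu>] gb hb])
  qed
  then have "set_integrable lborel fund_dom (\<lambda>t. \<Sum>\<mu>\<in>{0..<2 * int m}. of_real (Im t powr \<kappa>) * T \<mu> t / of_real ((Im t)\<^sup>2))"
    unfolding set_integrable_def scaleR_sum_right by (intro Bochner_Integration.integrable_sum)
  then have modular: "modular_integrable G"
    unfolding modular_integrable_def
    by (rule set_integrable_cong[THEN iffD1, OF refl refl, rotated]) (simp add: G up sum_divide_distrib)
  have fibre_eq: "(LINT z:fibre t|lborel. DJ k F t z) / of_real (Im t ^ 3)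
     = of_real (1 / sqrt (4 * real m)) * (G t / of_real ((Im t)\<^sup>2))" if t: "Im t > 0" for t
  proof -
    define v where "v = Im t"
    have v: "v > 0" using t by (simp add: v_def)
    have "(LINT z:fibre t|lborel. DJ k F t z) = of_real (v ^ k * (v * sqrt (1 / (4 * real m * v)))) * (\<Sum>\<mu>\<in>{0..<2 * int m}. T \<mu> t)"
      unfolding F_def T_def v_def \<kappa>_def by (rule fibre_integral_DJ(2)[OF m assms(6,7) g h t])
    moreover have "v ^ k * (v * sqrt (1 / (4 * real m * v))) / v ^ 3 = 1 / sqrt (4 * real m) * (v powr \<kappa> / v\<^sup>2)"
    proof -
      have pw: "v powr \<kappa> = v ^ k / sqrt v"
        using v by (simp add: \<kappa>_def powr_diff powr_realpow powr_half_sqrt)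
      show ?thesis
        unfolding pw using v by (simp add: real_sqrt_divide real_sqrt_mult field_simps power2_eq_square power3_eq_cube)
    qed
    then have "complex_of_real (v ^ k * (v * sqrt (1 / (4 * real m * v)))) / of_real (v ^ 3)
      = of_real (1 / sqrt (4 * real m)) * (of_real (v powr \<kappa>) / of_real (v\<^sup>2))"
      by (simp only: of_real_divide[symmetric] of_real_mult[symmetric])
    moreover have "I / Y = c * (p * S / w)" if "I = X * S" "X / Y = c * (p / w)" for I X Y S c p w :: complex
    proof -
      have "I / Y = X / Y * S" by (simp add: that(1))
      also have "\<dots> = c * (p * S / w)" by (simp add: that(2))
      finally show ?thesis .
    qed
    ultimately show ?thesis
      unfolding G[OF t] sum_distrib_left[symmetric] v_def[symmetric] by blast
  qed
  have "set_integrable lborel fund_dom (\<lambda>t. of_real (1 / sqrt (4 * real m)) * (G t / of_real ((Im t)\<^sup>2)))"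
    using modular unfolding modular_integrable_def by (rule set_integrable_mult_right)
  then have "set_integrable lborel fund_dom (\<lambda>t. (LINT z:fibre t|lborel. DJ k F t z) / of_real (Im t ^ 3))"
    by (rule set_integrable_cong[THEN iffD1, OF refl refl, rotated]) (simp only: fibre_eq up)
  moreover have "set_integrable lborel (fibre t) (DJ k F t)" if "t \<in> fund_dom" for t
    unfolding F_def by (rule set_integrable_fibre[OF fibre_integral_DJ(1)[OF m assms(6,7) g h up[OF that]]])
  ultimately have jacobi: "jacobi_integrable (DJ k F)"
    by (simp add: jacobi_integrable_def)
  have "jacobi_integral (DJ k F) = (LINT t:fund_dom|lborel. of_real (1 / sqrt (4 * real m)) * (G t / of_real ((Im t)\<^sup>2)))"
    unfolding jacobi_integral_def
    by (rule set_lebesgue_integral_cong) (use fibre_eq up in auto)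
  also have "\<dots> = of_real (1 / sqrt (4 * real m)) * modular_integral G"
    unfolding modular_integral_def by (rule set_integral_mult_right)
  finally show ?thesis using jacobi modular by blast
qed

end
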